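(* The operators $P_{\lambda^*}(\xi)$, $\xi\in(-\sqrt\pi,\sqrt\pi)$, and $P_{-1^\pm}$ are of finite rank into $L^2_w(\mathbb{R})$ and $H^{-1}_w(\mathbb{R})$, respectively. Moreover there are constants $\tilde C(\xi)$ (depending on $\xi$) and $\tilde C$ (independent of $\xi$) such that $$|(P_{\lambda^*}(\xi)f,g)_{L^2_w}|\le\tilde C(\xi)\|f\|_{L^2_w}\|g\|_{L^2_w}\quad\text{for all } f,g\in L^2_w(\mathbb{R})\text{ and all real }\xi\neq\pm\sqrt\pi,$$ $$|\langle P_{\lambda^*}(\xi)f,g\rangle|\le\tilde C\|f\|_{H^1_w}\|g\|_{H^1_w}\quad\text{for all } f,g\in H^1_w(\mathbb{R})\text{ and all }\xi\in\mathbb{R}.$$ Here at $\xi=\pm\sqrt\pi$ the symbol $P_{\lambda^*}(\xi)$ stands for $P_{-1^\pm}$.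
   Context: Let $w(v)=e^{-v^2}/\sqrt{\pi}$, $L^2_w=L^2_w(\mathbb{R})$ with $(f,g)_{L^2_w}=\int f\bar g\,w\,dv$; $H^1_w=\{f\in L^2_w:f'\in L^2_w\}$ with its natural norm, and $H^{-1}_w$ its dual with respect to the $L^2_w$ pairing. $\mathbb{1}$ is the constant function $1$; $(L_\xi f)(v)=(-iv\xi-1)f(v)+(f,\mathbb{1})_{L^2_w}\mathbb{1}$ with maximal domain in $L^2_w$. $\omega(\lambda,\xi)=1-\int_{\mathbb{R}}\frac{w(v)\,dv}{iv\xi+1+\lambda}$; for $\xi\in(-\sqrt\pi,\sqrt\pi)$, $\lambda^*(\xi)\in(-1,0]$ is its unique zero in $\lambda$, a simple isolated eigenvalue of $L_\xi$. $P_{\lambda^*}(\xi)$ is the Riesz projection of $L_\xi$ for $\lambda^*(\xi)$ if $\xi\in(-\sqrt\pi,\sqrt\pi)$, and $P_{\lambda^*}(\xi)=0$ if $\xi\notin[-\sqrt\pi,\sqrt\pi]$. $P_{-1^\pm}$ is minus the residue at $\lambda=-1$ of the continuation through $\mathrm{Re}\,\lambda=-1$, from $\mathrm{Re}\,\lambda>-1$, of $(L_{\pm\sqrt\pi}-\lambda)^{-1}$ in the sense of sesquilinear forms; explicitly, for $f,g\in H^1_w$, $$\langle P_{-1^\pm}f,g\rangle=\frac{1}{\omega_+'(-1,\pm\sqrt\pi)}\Big(\lim_{b\to0^\pm}\int_{\mathbb{R}}\frac{f(v)w(v)\,dv}{\pm i\sqrt\pi\,(v-ib)}\Big)\Big(\lim_{b\to0^\pm}\int_{\mathbb{R}}\frac{\overline{g(v)}w(v)\,dv}{\pm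 i\sqrt\pi\,(v-ib)}\Big),$$ where $\omega_+'(-1,\pm\sqrt\pi)=2/\pi$ is the $\lambda$-derivative at $\lambda=-1$ of the analytic continuation of $\omega(\cdot,\pm\sqrt\pi)$ from $\mathrm{Re}\,\lambda>-1$. For $\xi\ne\pm\sqrt\pi$, $\langle P_{\lambda^*}(\xi)f,g\rangle=(P_{\lambda^*}(\xi)f,g)_{L^2_w}$. *)

theory Defs
  imports "HOL-Complex_Analysis.Complex_Analysis"
begin

text \<open>
  Elements of the spaces below are represented by Borel functions \<^typ>\<open>real \<Rightarrow> complex\<close>;
  two representatives of the same element agree almost everywhere. All the notions that
  follow (norms, operators, rank) are understood up to equality almost everywhere.
\<close>

definition w :: "real \<Rightarrow> real"
  where "w v = exp (- v\<^sup>2) / sqrt pi"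

definition L2w :: "(real \<Rightarrow> complex) set"
  where "L2w = {f \<in> borel_measurable borel. integrable lborel (\<lambda>v. (cmod (f v))\<^sup>2 * w v)}"

definition inner_w :: "(real \<Rightarrow> complex) \<Rightarrow> (real \<Rightarrow> complex) \<Rightarrow> complex"
  where "inner_w f g = (LINT v|lborel. f v * cnj (g v) * complex_of_real (w v))"

definition norm_L2w :: "(real \<Rightarrow> complex) \<Rightarrow> real"
  where "norm_L2w f = sqrt (LINT v|lborel. (cmod (f v))\<^sup>2 * w v)"

definition test_function :: "(real \<Rightarrow> real) \<Rightarrow> bool"
  where "test_function \<phi> \<longleftrightarrow>
    (\<forall>n x. (deriv ^^ n) \<phi> differentiable (at x)) \<and> (\<exists>R. \<forall>x. R < \<bar>x\<bar> \<longrightarrow> \<phi> x = 0)"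

definition has_weak_deriv :: "(real \<Rightarrow> complex) \<Rightarrow> (real \<Rightarrow> complex) \<Rightarrow> bool"
  where "has_weak_deriv f f' \<longleftrightarrow>
    (\<forall>\<phi>. test_function \<phi> \<longrightarrow>
      (LINT v|lborel. f v * complex_of_real (deriv \<phi> v)) =
      - (LINT v|lborel. f' v * complex_of_real (\<phi> v)))"

definition H1w :: "(real \<Rightarrow> complex) set"
  where "H1w = {f \<in> L2w. \<exists>f'\<in>L2w. has_weak_deriv f f'}"

text \<open>A weak derivative is determined almost everywhere, so the choice does not affect the norm.\<close>

definition norm_H1w :: "(real \<Rightarrow> complex) \<Rightarrow> real"
  where "norm_H1w f =
    sqrt ((norm_L2w f)\<^sup>2 + (norm_L2w (SOME f'. f' \<in> L2w \<and> has_weak_deriv f f'))\<^sup>2)"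

text \<open>
  The dual is formed with respect to the pairing \<open>g \<mapsto> (f, g)\<close>, which is conjugate linear in
  \<open>g\<close>; its elements are therefore the bounded conjugate linear functionals. Only
  the values of a functional on \<^term>\<open>H1w\<close> are relevant.
\<close>

definition Hm1w :: "((real \<Rightarrow> complex) \<Rightarrow> complex) set"
  where "Hm1w = {\<Phi>.
    (\<forall>g\<in>H1w. \<forall>h\<in>H1w. \<forall>a b. \<Phi> (\<lambda>v. a * g v + b * h v) = cnj a * \<Phi> g + cnj b * \<Phi> h) \<and>
    (\<exists>C. \<forall>g\<in>H1w. cmod (\<Phi> g) \<le> C * norm_H1w g)}"

definition finite_rank_L2w :: "((real \<Rightarrow> complex) \<Rightarrow> real \<Rightarrow> complex) \<Rightarrow> bool"
  where "finite_rank_L2w T \<longleftrightarrow>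
    (\<forall>f\<in>L2w. T f \<in> L2w) \<and>
    (\<forall>f\<in>L2w. \<forall>g\<in>L2w. \<forall>a b.
       AE v in lborel. T (\<lambda>x. a * f x + b * g x) v = a * T f v + b * T g v) \<and>
    (\<exists>U. finite U \<and> U \<subseteq> L2w \<and>
       (\<forall>f\<in>L2w. \<exists>c. AE v in lborel. T f v = (\<Sum>u\<in>U. c u * u v)))"

definition finite_rank_Hm1w ::
    "((real \<Rightarrow> complex) \<Rightarrow> (real \<Rightarrow> complex) \<Rightarrow> complex) \<Rightarrow> bool"
  where "finite_rank_Hm1w T \<longleftrightarrow>
    (\<forall>f\<in>H1w. T f \<in> Hm1w) \<and>
    (\<forall>f\<in>H1w. \<forall>g\<in>H1w. \<forall>a b. \<forall>h\<in>H1w.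
       T (\<lambda>x. a * f x + b * g x) h = a * T f h + b * T g h) \<and>
    (\<exists>U. finite U \<and> U \<subseteq> Hm1w \<and>
       (\<forall>f\<in>H1w. \<exists>c. \<forall>h\<in>H1w. T f h = (\<Sum>u\<in>U. c u * u h)))"

definition L_op :: "real \<Rightarrow> (real \<Rightarrow> complex) \<Rightarrow> real \<Rightarrow> complex"
  where "L_op \<xi> f v = (- \<i> * complex_of_real (v * \<xi>) - 1) * f v + inner_w f (\<lambda>_. 1)"

definition L_dom :: "real \<Rightarrow> (real \<Rightarrow> complex) set"
  where "L_dom \<xi> = {f \<in> L2w. L_op \<xi> f \<in> L2w}"

definition resolvent_set :: "real \<Rightarrow> complex set"
  where "resolvent_set \<xi> = {z.
    (\<forall>f\<in>L2w. \<exists>u\<in>L_dom \<xi>. AE v in lborel. L_op \<xi> u v - z * u v = f v) \<and>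
    (\<exists>C. \<forall>u\<in>L_dom \<xi>. norm_L2w u \<le> C * norm_L2w (\<lambda>v. L_op \<xi> u v - z * u v))}"

text \<open>\<open>(L\<^sub>\<xi> - \<lambda>)\<^sup>-\<^sup>1 f\<close>, meaningful for \<open>\<lambda>\<close> in the resolvent set.\<close>

definition resolvent :: "real \<Rightarrow> complex \<Rightarrow> (real \<Rightarrow> complex) \<Rightarrow> real \<Rightarrow> complex"
  where "resolvent \<xi> z f =
    (SOME u. u \<in> L_dom \<xi> \<and> (AE v in lborel. L_op \<xi> u v - z * u v = f v))"

text \<open>
  \<open>- (1 / (2 \<pi> \<i>)) \<integral> (L\<^sub>\<xi> - \<lambda>)\<^sup>-\<^sup>1 f d\<lambda>\<close> over a positively oriented circle around an isolated
  point \<open>\<mu>\<close> of the spectrum, the circle neither meeting nor enclosing any other spectral point.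
  The operator-valued contour integral is the weak one: the result is the element of \<^term>\<open>L2w\<close>
  whose inner product with each \<open>g\<close> is the integral of the scalar function
  \<open>\<lambda> \<mapsto> ((L\<^sub>\<xi> - \<lambda>)\<^sup>-\<^sup>1 f, g)\<close>. This element does not depend on the radius.
\<close>

definition riesz_projection :: "real \<Rightarrow> complex \<Rightarrow> (real \<Rightarrow> complex) \<Rightarrow> real \<Rightarrow> complex"
  where "riesz_projection \<xi> \<mu> f =
    (SOME h. h \<in> L2w \<and>
      (\<exists>r>0. cball \<mu> r - {\<mu>} \<subseteq> resolvent_set \<xi> \<and>
        (\<forall>g\<in>L2w. \<exists>I. ((\<lambda>z. inner_w (resolvent \<xi> z f) g) has_contour_integral I) (circlepath \<mu> r) \<and>
           inner_w h g = - I / (2 * complex_of_real pi * \<i>))))"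

definition \<omega> :: "complex \<Rightarrow> real \<Rightarrow> complex"
  where "\<omega> z \<xi> =
    1 - (LINT v|lborel. complex_of_real (w v) / (\<i> * complex_of_real (v * \<xi>) + 1 + z))"

definition lambda_star :: "real \<Rightarrow> real"
  where "lambda_star \<xi> = (THE x. x \<in> {-1<..0} \<and> \<omega> (complex_of_real x) \<xi> = 0)"

definition P_lambda :: "real \<Rightarrow> (real \<Rightarrow> complex) \<Rightarrow> real \<Rightarrow> complex"
  where "P_lambda \<xi> f =
    (if \<bar>\<xi>\<bar> < sqrt pi then riesz_projection \<xi> (complex_of_real (lambda_star \<xi>)) f else (\<lambda>_. 0))"

text \<open>
  The derivative at \<open>-1\<close> of the analytic continuation of \<open>\<omega> (\<cdot>, \<xi>)\<close> from the half-plane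
  \<open>Re \<lambda> > -1\<close>. Every continuation \<open>F\<close> to an open set containing \<open>-1\<close> has the same derivative there;
  for \<open>\<xi> = \<plusminus>\<surd>\<pi>\<close> it equals \<open>2 / \<pi>\<close>.
\<close>

definition omega_plus_deriv :: "real \<Rightarrow> complex"
  where "omega_plus_deriv \<xi> =
    (THE d. \<exists>S F. open S \<and> connected S \<and> {z. - 1 < Re z} \<subseteq> S \<and> - 1 \<in> S \<and>
       F holomorphic_on S \<and> (\<forall>z. - 1 < Re z \<longrightarrow> F z = \<omega> z \<xi>) \<and> (F has_field_derivative d) (at (- 1)))"

text \<open>In the next two definitions \<open>\<xi>\<close> is \<open>\<surd>\<pi>\<close> or \<open>-\<surd>\<pi>\<close>; its sign is the side of the limit \<open>b \<rightarrow> 0\<close>.\<close>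

definition edge_limit :: "real \<Rightarrow> (real \<Rightarrow> complex) \<Rightarrow> complex"
  where "edge_limit \<xi> f =
    Lim (if 0 < \<xi> then at_right 0 else at_left 0)
      (\<lambda>b::real. LINT v|lborel. f v * complex_of_real (w v) /
         (\<i> * complex_of_real \<xi> * (complex_of_real v - \<i> * complex_of_real b)))"

text \<open>
  \<open>P_edge (\<plusminus>\<surd>\<pi>) f\<close> is the functional \<open>g \<mapsto> \<langle>P f, g\<rangle>\<close>. Minus the residue at \<open>-1\<close> of the
  resolvent form arises from the second term of
  \<open>((L\<^sub>\<xi> - \<lambda>)\<^sup>-\<^sup>1 f, g) = - \<integral> f g' w / d - (1 / \<omega>(\<lambda>, \<xi>)) (\<integral> f w / d) (\<integral> g' w / d)\<close>, where
  \<open>d = i v \<xi> + 1 + \<lambda>\<close> and \<open>g'\<close> is the complex conjugate of \<open>g\<close>: as real \<open>\<lambda>\<close> decreases to \<open>-1\<close>,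
  \<open>d\<close> becomes \<open>i \<xi> (v - i b)\<close> with \<open>b = (1 + \<lambda>) / \<xi> \<rightarrow> 0\<close> from the side given by the sign of \<open>\<xi>\<close>.
\<close>

definition P_edge :: "real \<Rightarrow> (real \<Rightarrow> complex) \<Rightarrow> (real \<Rightarrow> complex) \<Rightarrow> complex"
  where "P_edge \<xi> f g =
    1 / omega_plus_deriv \<xi> * edge_limit \<xi> f * edge_limit \<xi> (\<lambda>v. cnj (g v))"

definition P_pairing :: "real \<Rightarrow> (real \<Rightarrow> complex) \<Rightarrow> (real \<Rightarrow> complex) \<Rightarrow> complex"
  where "P_pairing \<xi> f g =
    (if \<bar>\<xi>\<bar> = sqrt pi then P_edge \<xi> f g else inner_w (P_lambda \<xi> f) g)"

end

theory Submission
  imports Defs "HOL-Probability.Characteristic_Functions" "HOL-Probability.Sinc_Integral"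
begin

text \<open>
  Write \<open>d = i v \<xi> + 1 + \<lambda>\<close> and \<open>A(f) = \<integral> f w / d\<close>. Solving \<open>(L\<^sub>\<xi> - \<lambda>) u = f\<close> by hand gives
  \<open>u = - (f + A(f) / \<omega>(\<lambda>, \<xi>)) / d\<close>, so for \<open>Re \<lambda> > -1\<close> the resolvent set is the set where
  \<open>\<omega>(\<lambda>, \<xi>) \<noteq> 0\<close>, and the scalar function \<open>((L\<^sub>\<xi> - \<lambda>)\<^sup>-\<^sup>1 f, g)\<close> has at the zero \<open>\<lambda>*\<close> a simple pole
  with residue \<open>- A(f) A(g') / D\<close>, where \<open>g'\<close> is the conjugate of \<open>g\<close> and \<open>D\<close> is the derivative
  of \<open>\<omega>(\<cdot>, \<xi>)\<close> at \<open>\<lambda>*\<close>. Hence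
  \<open>(P f, g) = A(f) A(g') / D\<close>, with \<open>A\<close> taken at \<open>\<lambda> = \<lambda>*\<close>: the Riesz projection has rank one, with
  range spanned by \<open>1 / d\<close> (lemma \<open>P_lambda_rank_one\<close>). The rank-one form of the edge operators is
  part of their definition. It remains to bound \<open>1 / D\<close> and \<open>A\<close>.

  The Fourier transform of the Gaussian turns \<open>\<omega>\<close> at real arguments into a Laplace integral,
  \<open>\<omega>(s - 1, \<xi>) = 1 - \<integral>\<^sub>0\<^sup>\<infinity> exp (- s t - t\<^sup>2 \<xi>\<^sup>2 / 4) dt\<close> (lemma \<open>omega_eq_laplace_gauss\<close>). The
  integral decreases strictly in \<open>s\<close>, at a rate bounded below uniformly in \<open>0 < s \<le> 3\<close>, \<open>\<bar>\<xi>\<bar> \<le> 2\<close>; this gives the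
  existence and uniqueness of \<open>\<lambda>*\<close>, a uniform lower bound on \<open>\<bar>D\<bar>\<close>, and a lower bound on
  \<open>1 + \<lambda>*\<close> for \<open>\<bar>\<xi>\<bar> \<le> 1\<close>.

  By the Cauchy--Schwarz inequality \<open>\<bar>A(f)\<bar> \<le> \<parallel>f\<parallel> / (1 + \<lambda>*)\<close>, which is the \<open>L\<^sup>2\<close> bound and, for
  \<open>\<bar>\<xi>\<bar> \<le> 1\<close>, also the uniform bound. It degenerates as \<open>\<bar>\<xi>\<bar> \<rightarrow> \<surd>\<pi>\<close>, where \<open>\<lambda>* \<rightarrow> -1\<close>. For
  \<open>1 \<le> \<bar>\<xi>\<bar> \<le> 2\<close> one writes \<open>1 / d\<close> as the derivative of \<open>Ln d / (i \<xi>)\<close> and integrates by parts: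
  \<open>i \<xi> A(f) = \<integral> (2 v f - f') w Ln d\<close>, with \<open>f'\<close> the weak derivative (lemma \<open>cauchy_w_by_parts\<close>).
  The logarithm is dominated, uniformly for \<open>-1 < \<lambda> \<le> 0\<close>, by a fixed
  square-integrable function, which gives a bound by the first-order norm that survives
  \<open>\<lambda> \<rightarrow> -1\<close>. By dominated convergence the limits defining the edge operators exist and satisfy
  the same bound.
\<close>

section \<open>The weighted space\<close>

lemma w_pos: "0 < w v"
  by (simp add: w_def)

lemma w_nonneg [simp]: "0 \<le> w v"
  by (simp add: w_def)

lemma w_measurable [measurable]: "w \<in> borel_measurable borel"
  unfolding w_def by measurable

lemma w_eq_normal_density: "w = normal_density 0 (1 / sqrt 2)"
  by (auto simp: fun_eq_iff w_def normal_density_def power_divide)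

lemma integrable_w_moment: "integrable lborel (\<lambda>v. w v * \<bar>v\<bar> ^ k)"
  using integrable_normal_moment_abs[where \<mu> = 0 and \<sigma> = "1 / sqrt 2" and k = k, simplified]
  unfolding w_eq_normal_density diff_0_right .

lemma integrable_w [simp]: "integrable lborel w"
  using integrable_w_moment[of 0] by simp

lemma integral_w [simp]: "(LINT v|lborel. w v) = 1"
  by (simp add: w_eq_normal_density)

lemma L2wI:
  assumes "f \<in> borel_measurable borel" "integrable lborel (\<lambda>v. (cmod (f v))\<^sup>2 * w v)"
  shows "f \<in> L2w"
  using assms by (simp add: L2w_def)

lemma L2w_measurable [measurable_dest]: "f \<in> L2w \<Longrightarrow> f \<in> borel_measurable borel"
  by (simp add: L2w_def)

lemma L2w_integrable: "f \<in> L2w \<Longrightarrow> integrable lborel (\<lambda>v. (cmod (f v))\<^sup>2 * w v)"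
  by (simp add: L2w_def)

lemma norm_L2w_nonneg [simp]: "0 \<le> norm_L2w f"
  by (simp add: norm_L2w_def)

lemma norm_L2w_power2: "(norm_L2w f)\<^sup>2 = (LINT v|lborel. (cmod (f v))\<^sup>2 * w v)"
  by (simp add: norm_L2w_def)

text \<open>
  The inequality is only required almost everywhere, so with \<open>C = 1\<close> this also transfers membership
  and norm between representatives of one element.
\<close>

lemma L2w_dominated:
  assumes g: "g \<in> L2w" and f [measurable]: "f \<in> borel_measurable borel"
    and le: "AE v in lborel. cmod (f v) \<le> C * cmod (g v)"
  shows "f \<in> L2w" "0 \<le> C \<Longrightarrow> norm_L2w f \<le> C * norm_L2w g"
proof -
  have int: "integrable lborel (\<lambda>v. C\<^sup>2 * ((cmod (g v))\<^sup>2 * w v))"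
    using L2w_integrable[OF g] by simp
  have le2: "AE v in lborel. (cmod (f v))\<^sup>2 * w v \<le> C\<^sup>2 * ((cmod (g v))\<^sup>2 * w v)"
    using le
  proof eventually_elim
    case (elim v)
    from power_mono[OF elim, of 2] have "(cmod (f v))\<^sup>2 \<le> C\<^sup>2 * (cmod (g v))\<^sup>2"
      by (simp add: power_mult_distrib)
    from mult_right_mono[OF this w_nonneg[of v]] show ?case
      by (simp add: mult_ac)
  qed
  have int_f: "integrable lborel (\<lambda>v. (cmod (f v))\<^sup>2 * w v)"
    by (rule Bochner_Integration.integrable_bound[OF int])
       (use le2 in \<open>auto elim!: eventually_mono\<close>)
  then show "f \<in> L2w"
    by (simp add: L2w_def)
  assume C: "0 \<le> C"
  have "(norm_L2w f)\<^sup>2 \<le> (C * norm_L2w g)\<^sup>2"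
    using integral_mono_AE[OF int_f int le2] by (simp add: norm_L2w_power2 power_mult_distrib)
  then show "norm_L2w f \<le> C * norm_L2w g"
    using C by (simp add: power2_le_iff_abs_le)
qed

lemma L2w_const [simp]: "(\<lambda>_. c) \<in> L2w"
  by (rule L2wI) auto

lemma norm_L2w_const: "norm_L2w (\<lambda>_. c) = cmod c"
  by (simp add: norm_L2w_def)

lemma L2w_scale: "f \<in> L2w \<Longrightarrow> (\<lambda>v. c * f v) \<in> L2w"
  by (rule L2w_dominated(1)[where g = f and C = "cmod c"]) (auto simp: norm_mult)

lemma L2w_cnj: "f \<in> L2w \<Longrightarrow> (\<lambda>v. cnj (f v)) \<in> L2w"
  by (rule L2w_dominated(1)[where g = f and C = 1]) (auto intro: measurable_compose[OF L2w_measurable borel_measurable_continuous_onI]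
      continuous_intros)

lemma norm_L2w_cnj: "norm_L2w (\<lambda>v. cnj (f v)) = norm_L2w f"
  by (simp add: norm_L2w_def)

lemma cmod_add_power2_le: "(cmod (a + b))\<^sup>2 \<le> 2 * (cmod a)\<^sup>2 + 2 * (cmod b)\<^sup>2"
proof -
  have "(cmod (a + b))\<^sup>2 \<le> (cmod a + cmod b)\<^sup>2"
    by (intro power_mono norm_triangle_ineq) auto
  also have "\<dots> \<le> 2 * (cmod a)\<^sup>2 + 2 * (cmod b)\<^sup>2"
    using zero_le_power2[of "cmod a - cmod b"] by (simp add: power2_eq_square algebra_simps)
  finally show ?thesis .
qed

lemma L2w_add:
  assumes [measurable_dest]: "f \<in> L2w" "g \<in> L2w"
  shows "(\<lambda>v. f v + g v) \<in> L2w"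
proof (rule L2wI)
  show "(\<lambda>v. f v + g v) \<in> borel_measurable borel"
    using assms by measurable
  have "integrable lborel (\<lambda>v. 2 * ((cmod (f v))\<^sup>2 * w v) + 2 * ((cmod (g v))\<^sup>2 * w v))"
    using assms by (simp add: L2w_integrable)
  then show "integrable lborel (\<lambda>v. (cmod (f v + g v))\<^sup>2 * w v)"
  proof (rule Bochner_Integration.integrable_bound)
    show "(\<lambda>v. (cmod (f v + g v))\<^sup>2 * w v) \<in> borel_measurable lborel"
      using assms by measurable
    show "AE v in lborel. norm ((cmod (f v + g v))\<^sup>2 * w v)
        \<le> norm (2 * ((cmod (f v))\<^sup>2 * w v) + 2 * ((cmod (g v))\<^sup>2 * w v))"
      using mult_right_mono[OF cmod_add_power2_le w_nonneg] by (simp add: algebra_simps)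
  qed
qed

lemma L2w_diff: "f \<in> L2w \<Longrightarrow> g \<in> L2w \<Longrightarrow> (\<lambda>v. f v - g v) \<in> L2w"
  using L2w_add[of f "\<lambda>v. - 1 * g v"] L2w_scale[of g "- 1"] by simp

text \<open>
  A quasi-triangle inequality suffices below, since only boundedness matters.
\<close>

lemma norm_L2w_add_le:
  assumes "f \<in> L2w" "g \<in> L2w"
  shows "norm_L2w (\<lambda>v. f v + g v) \<le> 2 * (norm_L2w f + norm_L2w g)"
proof -
  have "(norm_L2w (\<lambda>v. f v + g v))\<^sup>2
      \<le> (LINT v|lborel. 2 * ((cmod (f v))\<^sup>2 * w v) + 2 * ((cmod (g v))\<^sup>2 * w v))"
    unfolding norm_L2w_power2
  proof (rule integral_mono)
    show "integrable lborel (\<lambda>v. (cmod (f v + g v))\<^sup>2 * w v)"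
      using assms by (intro L2w_integrable L2w_add)
    show "(cmod (f v + g v))\<^sup>2 * w v \<le> 2 * ((cmod (f v))\<^sup>2 * w v) + 2 * ((cmod (g v))\<^sup>2 * w v)" for v
      using mult_right_mono[OF cmod_add_power2_le w_nonneg, of "f v" "g v" v]
      by (simp add: algebra_simps)
  qed (use assms in \<open>simp add: L2w_integrable\<close>)
  also have "\<dots> = 2 * (norm_L2w f)\<^sup>2 + 2 * (norm_L2w g)\<^sup>2"
    using assms by (simp add: L2w_integrable norm_L2w_power2)
  also have "\<dots> \<le> (2 * (norm_L2w f + norm_L2w g))\<^sup>2"
    by (simp add: power2_eq_square algebra_simps)
  finally show ?thesis
    by (rule power2_le_imp_le) simp
qed

lemma L2w_mult_integrable:
  assumes "f \<in> L2w" "g \<in> L2w"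
  shows "integrable lborel (\<lambda>v. f v * g v * of_real (w v))"
proof (rule Bochner_Integration.integrable_bound)
  show "integrable lborel (\<lambda>v. (cmod (f v))\<^sup>2 * w v + (cmod (g v))\<^sup>2 * w v)"
    using assms by (simp add: L2w_integrable)
  show "(\<lambda>v. f v * g v * complex_of_real (w v)) \<in> borel_measurable lborel"
    using assms by measurable
  have "cmod a * cmod b \<le> (cmod a)\<^sup>2 + (cmod b)\<^sup>2" for a b
    using sum_squares_bound[of "cmod a" "cmod b"]
      mult_nonneg_nonneg[OF norm_ge_zero[of a] norm_ge_zero[of b]] by linarith
  then have "cmod (f v) * cmod (g v) * w v \<le> ((cmod (f v))\<^sup>2 + (cmod (g v))\<^sup>2) * w v" for v
    by (intro mult_right_mono) auto
  then show "AE v in lborel. norm (f v * g v * complex_of_real (w v))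
      \<le> norm ((cmod (f v))\<^sup>2 * w v + (cmod (g v))\<^sup>2 * w v)"
    by (simp add: norm_mult algebra_simps)
qed

text \<open>
  Stated for the bilinear pairing, without a conjugate on \<open>g\<close>.
\<close>

lemma L2w_Cauchy_Schwarz:
  assumes f: "f \<in> L2w" and g: "g \<in> L2w"
  shows "cmod (LINT v|lborel. f v * g v * of_real (w v)) \<le> norm_L2w f * norm_L2w g"
proof -
  let ?I = "LINT v|lborel. cmod (f v) * cmod (g v) * w v"
  have int: "integrable lborel (\<lambda>v. cmod (f v) * cmod (g v) * w v)"
    using integrable_norm[OF L2w_mult_integrable[OF f g]] by (simp add: norm_mult)
  note [measurable] = L2w_measurable[OF f] L2w_measurable[OF g]
  have I0: "0 \<le> ?I" by (intro integral_nonneg_AE) auto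
  have nn: "(\<integral>\<^sup>+v. ennreal ((cmod (h v))\<^sup>2 * w v) \<partial>lborel) = ennreal ((norm_L2w h)\<^sup>2)" if "h \<in> L2w" for h
    unfolding norm_L2w_power2 using that by (intro nn_integral_eq_integral L2w_integrable) auto
  have sq: "ennreal (cmod (h v) * sqrt (w v)) ^ 2 = ennreal ((cmod (h v))\<^sup>2 * w v)" for h v
    by (simp add: ennreal_power power_mult_distrib)
  have pr: "ennreal (cmod (f v) * sqrt (w v)) * ennreal (cmod (g v) * sqrt (w v))
      = ennreal (cmod (f v) * cmod (g v) * w v)" for v
    by (simp add: ennreal_mult[symmetric] algebra_simps)
  have "(\<integral>\<^sup>+v. ennreal (cmod (f v) * sqrt (w v)) * ennreal (cmod (g v) * sqrt (w v)) \<partial>lborel)\<^sup>2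
    \<le> (\<integral>\<^sup>+v. ennreal (cmod (f v) * sqrt (w v)) ^ 2 \<partial>lborel) *
      (\<integral>\<^sup>+v. ennreal (cmod (g v) * sqrt (w v)) ^ 2 \<partial>lborel)"
    by (rule Cauchy_Schwarz_nn_integral) measurable
  then have "(ennreal ?I)\<^sup>2 \<le> ennreal ((norm_L2w f)\<^sup>2) * ennreal ((norm_L2w g)\<^sup>2)"
    unfolding sq pr nn[OF f] nn[OF g] using int by (subst (asm) nn_integral_eq_integral) auto
  then have "?I\<^sup>2 \<le> (norm_L2w f * norm_L2w g)\<^sup>2"
    using I0 by (simp add: ennreal_power ennreal_mult[symmetric] power_mult_distrib)
  then have "?I \<le> norm_L2w f * norm_L2w g"
    by (rule power2_le_imp_le) simp
  moreover have "cmod (LINT v|lborel. f v * g v * of_real (w v)) \<le> ?I"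
    using integral_norm_bound[of lborel "\<lambda>v. f v * g v * of_real (w v)"] by (simp add: norm_mult)
  ultimately show ?thesis by linarith
qed

lemma L2w_integrable_w: "f \<in> L2w \<Longrightarrow> integrable lborel (\<lambda>v. f v * of_real (w v))"
  using L2w_mult_integrable[of f "\<lambda>_. 1"] by simp

lemma norm_L2w_eq_0_imp:
  assumes "f \<in> L2w" "norm_L2w f = 0"
  shows "AE v in lborel. f v = 0"
proof -
  have "(LINT v|lborel. (cmod (f v))\<^sup>2 * w v) = 0"
    using assms norm_L2w_power2[of f] by simp
  then have "AE v in lborel. (cmod (f v))\<^sup>2 * w v = 0"
    by (subst (asm) integral_nonneg_eq_0_iff_AE) (use assms in \<open>auto simp: L2w_integrable\<close>)
  then show ?thesis
    by eventually_elim (simp add: less_imp_neq[OF w_pos, symmetric])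
qed

lemma L2w_eq_if_inner_eq:
  assumes h: "h \<in> L2w" and k: "k \<in> L2w" and eq: "\<And>g. g \<in> L2w \<Longrightarrow> inner_w h g = inner_w k g"
  shows "AE v in lborel. h v = k v"
proof -
  let ?d = "\<lambda>v. h v - k v"
  have d: "?d \<in> L2w" using h k by (rule L2w_diff)
  have "inner_w ?d ?d = inner_w h ?d - inner_w k ?d"
    unfolding inner_w_def using L2w_mult_integrable[OF h L2w_cnj[OF d]] L2w_mult_integrable[OF k L2w_cnj[OF d]]
    by (subst Bochner_Integration.integral_diff[symmetric]) (auto simp: algebra_simps)
  then have "inner_w ?d ?d = 0"
    using eq[OF d] by simp
  moreover have "inner_w ?d ?d = of_real ((norm_L2w ?d)\<^sup>2)"
    unfolding inner_w_def norm_L2w_power2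
    by (simp add: complex_norm_square[symmetric] integral_complex_of_real[symmetric] del: complex_cnj_diff integral_complex_of_real)
  ultimately have "norm_L2w ?d = 0" by simp
  from norm_L2w_eq_0_imp[OF d this] show ?thesis by simp
qed

section \<open>The dispersion function and its real zero\<close>

text \<open>
  The symbol \<open>i v \<xi> + 1 + \<lambda>\<close> of the multiplication part of \<open>\<lambda> - L\<^sub>\<xi>\<close>. For \<open>Re \<lambda> > -1\<close> its modulus is at
  least \<open>1 + Re \<lambda>\<close>.
\<close>

definition den :: "real \<Rightarrow> complex \<Rightarrow> real \<Rightarrow> complex"
  where "den \<xi> z v = \<i> * complex_of_real (v * \<xi>) + 1 + z"

text \<open>
  The Cauchy-type integral \<open>A(f) = \<integral> f w / (i v \<xi> + 1 + \<lambda>)\<close>. It is linear in \<open>f\<close>: the second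
  argument of the resolvent form enters through its conjugate, as \<open>A(g')\<close>.
\<close>

definition cauchy_w :: "real \<Rightarrow> complex \<Rightarrow> (real \<Rightarrow> complex) \<Rightarrow> complex"
  where "cauchy_w \<xi> z f = (LINT v|lborel. f v * complex_of_real (w v) / den \<xi> z v)"

lemma den_measurable [measurable]: "den \<xi> z \<in> borel_measurable borel"
  unfolding den_def[abs_def] by measurable

lemma Re_den [simp]: "Re (den \<xi> z v) = 1 + Re z"
  by (simp add: den_def)

lemma cmod_den_ge: "1 + Re z \<le> cmod (den \<xi> z v)"
  using complex_Re_le_cmod[of "den \<xi> z v"] by simp

lemma den_nonzero: "- 1 < Re z \<Longrightarrow> den \<xi> z v \<noteq> 0"
  using Re_den[of \<xi> z v] by (auto simp del: Re_den)

lemma omega_eq_cauchy_w: "\<omega> z \<xi> = 1 - cauchy_w \<xi> z (\<lambda>_. 1)"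
  by (simp add: \<omega>_def cauchy_w_def den_def)

lemma cmod_inverse_den_le:
  assumes "- 1 < Re z"
  shows "cmod (1 / den \<xi> z v) \<le> 1 / (1 + Re z)"
  using assms cmod_den_ge[of z \<xi> v] by (simp add: norm_divide frac_le)

lemma inverse_den_L2w:
  assumes "- 1 < Re z"
  shows "(\<lambda>v. 1 / den \<xi> z v) \<in> L2w" "norm_L2w (\<lambda>v. 1 / den \<xi> z v) \<le> 1 / (1 + Re z)"
proof -
  have b: "AE v in lborel. cmod (1 / den \<xi> z v) \<le> 1 / (1 + Re z) * cmod 1"
    using cmod_inverse_den_le[OF assms] by auto
  have m: "(\<lambda>v. 1 / den \<xi> z v) \<in> borel_measurable borel" by measurable
  show "(\<lambda>v. 1 / den \<xi> z v) \<in> L2w"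
    by (rule L2w_dominated(1)[OF _ m b]) simp
  show "norm_L2w (\<lambda>v. 1 / den \<xi> z v) \<le> 1 / (1 + Re z)"
    using L2w_dominated(2)[OF _ m b] assms by (simp add: norm_L2w_const)
qed

lemma cauchy_w_integrable:
  assumes "f \<in> L2w" "- 1 < Re z"
  shows "integrable lborel (\<lambda>v. f v * complex_of_real (w v) / den \<xi> z v)"
  using L2w_mult_integrable[OF assms(1) inverse_den_L2w(1)[OF assms(2)]] by simp

lemma cmod_cauchy_w_le:
  assumes "f \<in> L2w" "- 1 < Re z"
  shows "cmod (cauchy_w \<xi> z f) \<le> norm_L2w f / (1 + Re z)"
proof -
  have "cmod (cauchy_w \<xi> z f) \<le> norm_L2w f * norm_L2w (\<lambda>v. 1 / den \<xi> z v)"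
    using L2w_Cauchy_Schwarz[OF assms(1) inverse_den_L2w(1)[OF assms(2)], of \<xi>] by (simp add: cauchy_w_def)
  also have "\<dots> \<le> norm_L2w f * (1 / (1 + Re z))"
    by (intro mult_left_mono inverse_den_L2w(2) assms norm_L2w_nonneg)
  finally show ?thesis by simp
qed

lemma cauchy_w_linear:
  assumes "f \<in> L2w" "g \<in> L2w" "- 1 < Re z"
  shows "cauchy_w \<xi> z (\<lambda>v. a * f v + b * g v) = a * cauchy_w \<xi> z f + b * cauchy_w \<xi> z g"
proof -
  have "cauchy_w \<xi> z (\<lambda>v. a * f v + b * g v)
     = (LINT v|lborel. a * (f v * complex_of_real (w v) / den \<xi> z v) + b * (g v * complex_of_real (w v) / den \<xi> z v))"
    unfolding cauchy_w_def by (intro Bochner_Integration.integral_cong) (auto simp: algebra_simps add_divide_distrib)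
  also have "\<dots> = a * cauchy_w \<xi> z f + b * cauchy_w \<xi> z g"
    unfolding cauchy_w_def using cauchy_w_integrable[OF assms(1,3), of \<xi>] cauchy_w_integrable[OF assms(2,3), of \<xi>]
    by (simp del: times_divide_eq_right)
  finally show ?thesis .
qed

lemma integrable_divide_den:
  assumes "integrable lborel h" "- 1 < Re z"
  shows "integrable lborel (\<lambda>v. h v / den \<xi> z v)"
proof (rule Bochner_Integration.integrable_bound)
  show "integrable lborel (\<lambda>v. (1 / (1 + Re z)) * cmod (h v))"
    using assms by simp
  show "(\<lambda>v. h v / den \<xi> z v) \<in> borel_measurable lborel"
    using assms by measurable
  show "AE v in lborel. cmod (h v / den \<xi> z v) \<le> norm ((1 / (1 + Re z)) * cmod (h v))"
    using mult_right_mono[OF cmod_inverse_den_le[OF assms(2)] norm_ge_zero, of \<xi> _ "h _"] assms(2)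
    by (auto simp: norm_divide abs_mult)
qed

text \<open>
  The difference quotient differs from the candidate derivative \<open>- \<integral> h / d\<^sup>2\<close> by
  \<open>(y - z) \<integral> h / (d\<^sub>z\<^sup>2 d\<^sub>y)\<close>, which is \<open>O(y - z)\<close> because both denominators stay away from \<open>0\<close>.
\<close>

lemma integral_divide_den_holomorphic:
  assumes h: "integrable lborel h"
  shows "(\<lambda>z. LINT v|lborel. h v / den \<xi> z v) holomorphic_on {z. - 1 < Re z}"
proof (rule holomorphic_onI)
  fix z :: complex assume "z \<in> {z. - 1 < Re z}"
  then have z: "- 1 < Re z" by simp
  \<comment> \<open>half the distance from \<open>z\<close> to the line \<open>Re = -1\<close>\<close>
  define s where "s = (1 + Re z) / 2"
  have s: "0 < s" using z by (simp add: s_def)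
  let ?H = "\<lambda>z. LINT v|lborel. h v / den \<xi> z v"
  let ?D = "- (LINT v|lborel. h v / den \<xi> z v / den \<xi> z v)"
  define K where "K = (LINT v|lborel. cmod (h v)) / s ^ 3"
  have est: "cmod ((?H y - ?H z) / (y - z) - ?D) \<le> K * cmod (y - z)" if y: "dist y z < s" "y \<noteq> z" for y
  proof -
    have "\<bar>Re y - Re z\<bar> < s"
      using y abs_Re_le_cmod[of "y - z"] by (simp add: dist_norm)
    moreover have "2 * s = 1 + Re z" by (simp add: s_def)
    ultimately have Re_y: "s < 1 + Re y" "- 1 < Re y"
      using s by linarith+
    note i = integrable_divide_den[OF h Re_y(2), of \<xi>] integrable_divide_den[OF h z, of \<xi>]
      integrable_divide_den[OF integrable_divide_den[OF h z, of \<xi>] z, of \<xi>]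
    have i3: "integrable lborel (\<lambda>v. h v / den \<xi> z v / den \<xi> z v / den \<xi> y v)"
      by (rule integrable_divide_den[OF i(3) Re_y(2)])
    have pw: "(h v / den \<xi> y v - h v / den \<xi> z v) / (y - z) + h v / den \<xi> z v / den \<xi> z v
        = (y - z) * (h v / den \<xi> z v / den \<xi> z v / den \<xi> y v)" for v
    proof -
      have nz: "den \<xi> y v \<noteq> 0" "den \<xi> z v \<noteq> 0" "y - z \<noteq> 0"
        using den_nonzero z Re_y y by auto
      have dy: "den \<xi> y v = den \<xi> z v + (y - z)" by (simp add: den_def)
      have "(a / (d + e) - a / d) / e + a / d / d = e * (a / d / d / (d + e))"
        if "d \<noteq> 0" "e \<noteq> 0" "d + e \<noteq> 0" for a d e :: complex
        using that by (simp add: divide_simps) (simp add: algebra_simps)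
      from this[of "den \<xi> z v" "y - z" "h v"] show ?thesis
        using nz unfolding dy by simp
    qed
    have "(?H y - ?H z) / (y - z) - ?D
      = (LINT v|lborel. (h v / den \<xi> y v - h v / den \<xi> z v) / (y - z) + h v / den \<xi> z v / den \<xi> z v)"
      using i by simp
    also have "\<dots> = (y - z) * (LINT v|lborel. h v / den \<xi> z v / den \<xi> z v / den \<xi> y v)"
      unfolding pw by (rule integral_mult_right_zero)
    finally have eq: "cmod ((?H y - ?H z) / (y - z) - ?D)
      = cmod (y - z) * cmod (LINT v|lborel. h v / den \<xi> z v / den \<xi> z v / den \<xi> y v)"
      by (simp add: norm_mult)
    have "cmod (LINT v|lborel. h v / den \<xi> z v / den \<xi> z v / den \<xi> y v)
       \<le> (LINT v|lborel. cmod (h v) / s ^ 3)"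
    proof (rule Bochner_Integration.integral_norm_bound_integral)
      fix v
      have d: "s \<le> cmod (den \<xi> y v)" "s \<le> cmod (den \<xi> z v)"
        using cmod_den_ge[of y \<xi> v] cmod_den_ge[of z \<xi> v] Re_y s by (auto simp: s_def)
      then have "s * s * s \<le> cmod (den \<xi> z v) * cmod (den \<xi> z v) * cmod (den \<xi> y v)"
        using s by (intro mult_mono) auto
      then show "cmod (h v / den \<xi> z v / den \<xi> z v / den \<xi> y v) \<le> cmod (h v) / s ^ 3"
        using s frac_le[of "cmod (h v)" "cmod (h v)"] by (simp add: norm_divide norm_mult power3_eq_cube)
    qed (use i3 h in auto)
    also have "\<dots> = K"
      by (simp add: K_def)
    finally show ?thesis
      unfolding eq mult.commute[of K] by (rule mult_left_mono) simp
  qed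
  have "(\<lambda>y. (?H y - ?H z) / (y - z) - ?D) \<midarrow>z\<rightarrow> 0"
  proof (rule Lim_null_comparison)
    show "\<forall>\<^sub>F y in at z. norm ((?H y - ?H z) / (y - z) - ?D) \<le> K * cmod (y - z)"
      using est s unfolding eventually_at by blast
    show "(\<lambda>y. K * cmod (y - z)) \<midarrow>z\<rightarrow> 0"
      by (auto intro!: tendsto_eq_intros)
  qed
  then have "(?H has_field_derivative ?D) (at z)"
    unfolding has_field_derivative_iff by (rule LIM_zero_cancel)
  then show "?H field_differentiable (at z within {z. - 1 < Re z})"
    using field_differentiable_at_within field_differentiable_def by blast
qed

lemma cauchy_w_holomorphic:
  "f \<in> L2w \<Longrightarrow> (\<lambda>z. cauchy_w \<xi> z f) holomorphic_on {z. - 1 < Re z}"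
  unfolding cauchy_w_def by (intro integral_divide_den_holomorphic L2w_integrable_w)

lemma omega_holomorphic: "(\<lambda>z. \<omega> z \<xi>) holomorphic_on {z. - 1 < Re z}"
  unfolding omega_eq_cauchy_w by (intro holomorphic_intros cauchy_w_holomorphic) simp

subsection \<open>A Laplace integral\<close>

text \<open>
  The Laplace transform, at \<open>s\<close>, of the Gaussian \<open>t \<mapsto> exp (- t\<^sup>2 \<xi>\<^sup>2 / 4)\<close> on the half-line; by
  lemma \<open>omega_eq_laplace_gauss\<close> below it is \<open>1 - \<omega>(s - 1, \<xi>)\<close>.
\<close>

definition laplace_gauss :: "real \<Rightarrow> real \<Rightarrow> real"
  where "laplace_gauss \<xi> s = (LINT t:{0<..}|lborel. exp (- s * t - t\<^sup>2 * \<xi>\<^sup>2 / 4))"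

lemma laplace_gauss_integrable:
  fixes s \<xi> :: real
  assumes "0 < s"
  shows "set_integrable lborel {0<..} (\<lambda>t. exp (- s * t - t\<^sup>2 * \<xi>\<^sup>2 / 4))"
proof (rule set_integrable_bound[OF integrable_I0i_exp_mscale[OF assms]])
  show "set_borel_measurable lborel {0<..} (\<lambda>t. exp (- s * t - t\<^sup>2 * \<xi>\<^sup>2 / 4))"
    unfolding set_borel_measurable_def by measurable
qed (auto simp: mult.commute)

lemma fourier_w:
  "(LINT v|lborel. complex_of_real (w v) * exp (- (\<i> * complex_of_real (v * \<xi>)) * complex_of_real t))
    = complex_of_real (exp (- t\<^sup>2 * \<xi>\<^sup>2 / 4))"
proof -
  let ?u = "- \<xi> * t / sqrt 2"
  have "complex_of_real (exp (- (?u\<^sup>2) / 2)) = char std_normal_distribution ?u"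
    by (simp add: char_std_normal_distribution)
  also have "\<dots> = (LINT x|lborel. complex_of_real (std_normal_density x) * iexp (?u * x))"
    unfolding char_def by (subst integral_density) (auto simp: scaleR_conv_of_real)
  also have "\<dots> = (LINT v|lborel. complex_of_real (sqrt 2) * (complex_of_real (std_normal_density (sqrt 2 * v)) * iexp (?u * (sqrt 2 * v))))"
    by (subst lborel_integral_real_affine[where c = "sqrt 2" and t = 0]) (auto simp: scaleR_conv_of_real)
  also have "\<dots> = (LINT v|lborel. complex_of_real (w v) * exp (- (\<i> * complex_of_real (v * \<xi>)) * complex_of_real t))"
  proof (rule Bochner_Integration.integral_cong[OF refl])
    fix v
    have 1: "sqrt 2 * std_normal_density (sqrt 2 * v) = w v"
      by (simp add: std_normal_density_def w_def power_mult_distrib real_sqrt_mult)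
    have 2: "?u * (sqrt 2 * v) = - (v * \<xi>) * t" by simp
    show "complex_of_real (sqrt 2) * (complex_of_real (std_normal_density (sqrt 2 * v)) * iexp (?u * (sqrt 2 * v)))
      = complex_of_real (w v) * exp (- (\<i> * complex_of_real (v * \<xi>)) * complex_of_real t)"
      unfolding 2 mult.assoc[symmetric] of_real_mult[symmetric] 1 by (simp add: mult_ac)
  qed
  finally show ?thesis
    by (simp add: power_divide power_mult_distrib mult_ac)
qed

lemma inverse_eq_laplace:
  assumes "0 < Re d"
  shows "set_integrable lborel {0<..} (\<lambda>t. exp (- d * complex_of_real t))"
    and "(LINT t:{0<..}|lborel. exp (- d * complex_of_real t)) = 1 / d"
proof -
  have norm: "cmod (exp (- d * complex_of_real t)) = exp (- (t * Re d))" for t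
    by simp
  show si: "set_integrable lborel {0<..} (\<lambda>t. exp (- d * complex_of_real t))"
  proof (rule set_integrable_bound[OF integrable_I0i_exp_mscale[OF assms]])
    show "set_borel_measurable lborel {0<..} (\<lambda>t. exp (- d * complex_of_real t))"
      unfolding set_borel_measurable_def by measurable
  qed (simp add: norm)
  have "d \<noteq> 0" using assms by auto
  have "(LBINT t=0..\<infinity>. exp (- d * complex_of_real t)) = 0 - (- 1 / d)"
  proof (rule interval_integral_FTC_integrable[where F = "\<lambda>t. - exp (- d * complex_of_real t) / d"])
    show "set_integrable lborel (einterval 0 \<infinity>) (\<lambda>t. exp (- d * complex_of_real t))"
      using si by (simp add: einterval_def greaterThan_def)
    show "((\<lambda>t. - exp (- d * complex_of_real t) / d) has_vector_derivative exp (- d * complex_of_real x)) (at x)" for x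
      using \<open>d \<noteq> 0\<close>
      by (auto intro!: derivative_eq_intros has_vector_derivative_real_field)
    have "((\<lambda>t. - exp (- d * complex_of_real t) / d) \<longlongrightarrow> - exp (- d * complex_of_real 0) / d) (at_right 0)"
      using \<open>d \<noteq> 0\<close> by (intro tendsto_intros)
    then show "(((\<lambda>t. - exp (- d * complex_of_real t) / d) \<circ> real_of_ereal) \<longlongrightarrow> - 1 / d) (at_right 0)"
      by (simp add: ereal_tendsto_simps zero_ereal_def)
    have "filterlim (\<lambda>t. t * Re d) at_top at_top"
      using assms by (intro filterlim_at_top_mult_tendsto_pos[of _ "Re d"] filterlim_ident tendsto_const)
    then have "((\<lambda>t. exp (- (t * Re d))) \<longlongrightarrow> 0) at_top"
      by (intro filterlim_compose[OF exp_at_bot] filterlim_compose[OF filterlim_uminus_at_bot_at_top])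
    then have "((\<lambda>t. exp (- d * complex_of_real t)) \<longlongrightarrow> 0) at_top"
      unfolding norm[symmetric] by (rule tendsto_norm_zero_cancel)
    from tendsto_divide[OF tendsto_minus[OF this] tendsto_const[of d]]
    have "((\<lambda>t. - exp (- d * complex_of_real t) / d) \<longlongrightarrow> 0) at_top"
      using \<open>d \<noteq> 0\<close> by simp
    then show "(((\<lambda>t. - exp (- d * complex_of_real t) / d) \<circ> real_of_ereal) \<longlongrightarrow> 0) (at_left \<infinity>)"
      by (simp add: ereal_tendsto_simps)
  qed auto
  then show "(LINT t:{0<..}|lborel. exp (- d * complex_of_real t)) = 1 / d"
    by (simp add: interval_lebesgue_integral_0_infty)
qed

text \<open>
  Write \<open>1 / d = \<integral>\<^sub>0\<^sup>\<infinity> exp (- d t) dt\<close>, exchange the integrals, and evaluate the inner one as a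
  Fourier transform of \<open>w\<close>.
\<close>

lemma omega_eq_laplace_gauss:
  assumes s: "0 < s"
  shows "\<omega> (complex_of_real (s - 1)) \<xi> = complex_of_real (1 - laplace_gauss \<xi> s)"
proof -
  let ?z = "complex_of_real (s - 1)"
  define F where "F = (\<lambda>v t. indicat_real {0<..} t *\<^sub>R (complex_of_real (w v) * exp (- den \<xi> ?z v * complex_of_real t)))"
  have cmodF: "cmod (F v t) = w v * (indicat_real {0<..} t *\<^sub>R exp (- (t * s)))" for v t
    by (simp add: F_def norm_mult)
  have F_meas: "case_prod F \<in> borel_measurable (lborel \<Otimes>\<^sub>M lborel)"
    unfolding F_def by measurable
  have Fv: "integrable lborel (F v)" "integral\<^sup>L lborel (F v) = complex_of_real (w v) / den \<xi> ?z v" for v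
  proof -
    have d: "0 < Re (den \<xi> ?z v)" using s by simp
    have eq: "F v = (\<lambda>t. complex_of_real (w v) * (indicat_real {0<..} t *\<^sub>R exp (- den \<xi> ?z v * complex_of_real t)))"
      by (simp add: F_def fun_eq_iff)
    show "integrable lborel (F v)"
      unfolding eq using inverse_eq_laplace(1)[OF d] unfolding set_integrable_def
      by (rule integrable_mult_right)
    show "integral\<^sup>L lborel (F v) = complex_of_real (w v) / den \<xi> ?z v"
      unfolding eq integral_mult_right_zero
      using inverse_eq_laplace(2)[OF d] by (simp add: set_lebesgue_integral_def)
  qed
  have "integrable (lborel \<Otimes>\<^sub>M lborel) (case_prod F)"
    by (rule lborel_pair.Fubini_integrable) (use F_meas Fv(1) in \<open>simp_all add: cmodF\<close>)
  from lborel_pair.Fubini_integral[OF this]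
  have "(LINT t|lborel. LINT v|lborel. F v t) = cauchy_w \<xi> ?z (\<lambda>_. 1)"
    by (simp add: Fv(2) cauchy_w_def)
  moreover have "(LINT v|lborel. F v t)
      = complex_of_real (indicat_real {0<..} t *\<^sub>R exp (- s * t - t\<^sup>2 * \<xi>\<^sup>2 / 4))" for t
  proof -
    have "F v t = (indicat_real {0<..} t *\<^sub>R exp (- s * t)) *
        (complex_of_real (w v) * exp (- (\<i> * complex_of_real (v * \<xi>)) * complex_of_real t))" for v
      by (simp add: F_def den_def scaleR_conv_of_real exp_of_real[symmetric] exp_add[symmetric] algebra_simps)
    then have "(LINT v|lborel. F v t) = (indicat_real {0<..} t *\<^sub>R exp (- s * t)) * complex_of_real (exp (- t\<^sup>2 * \<xi>\<^sup>2 / 4))"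
      by (simp only: integral_mult_right_zero fourier_w)
    moreover have "exp (- s * t) * exp (- t\<^sup>2 * \<xi>\<^sup>2 / 4) = exp (- s * t - t\<^sup>2 * \<xi>\<^sup>2 / 4)"
      by (simp add: exp_add[symmetric])
    ultimately show ?thesis
      by (simp only: real_scaleR_def of_real_mult[symmetric] mult.assoc)
  qed
  ultimately have "cauchy_w \<xi> ?z (\<lambda>_. 1) = complex_of_real (laplace_gauss \<xi> s)"
    by (simp only: integral_complex_of_real laplace_gauss_def set_lebesgue_integral_def)
  then show ?thesis by (simp add: omega_eq_cauchy_w)
qed

lemma gauss_half_line:
  assumes "0 < \<eta>"
  shows "has_bochner_integral lborel (\<lambda>t. indicator {0<..} t *\<^sub>R exp (- t\<^sup>2 * \<eta>\<^sup>2 / 4)) (sqrt pi / \<eta>)"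
    and "has_bochner_integral lborel (\<lambda>t. indicator {0<..} t *\<^sub>R (t * exp (- t\<^sup>2 * \<eta>\<^sup>2 / 4))) (2 / \<eta>\<^sup>2)"
proof -
  have c: "\<eta> / 2 \<noteq> 0" using assms by simp
  have ind: "AE t in lborel. indicat_real {0..} (0 + \<eta> / 2 * t) = indicat_real {0<..} t"
    using AE_lborel_singleton[of 0]
    by eventually_elim (use assms in \<open>auto simp: indicator_def zero_le_mult_iff\<close>)
  from gaussian_moment_0
  have *: "has_bochner_integral lborel (\<lambda>t. indicat_real {0..} (0 + \<eta> / 2 * t) *\<^sub>R exp (- (0 + \<eta> / 2 * t)\<^sup>2)) (sqrt pi / \<eta>)"
    by (subst (asm) lborel_has_bochner_integral_real_affine_iff[OF c, of _ _ 0]) (use assms in simp)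
  show "has_bochner_integral lborel (\<lambda>t. indicator {0<..} t *\<^sub>R exp (- t\<^sup>2 * \<eta>\<^sup>2 / 4)) (sqrt pi / \<eta>)"
    by (rule has_bochner_integral_cong_AE[THEN iffD1, OF _ _ _ *])
       (use ind in \<open>auto simp: power_mult_distrib power_divide mult_ac elim!: eventually_mono\<close>)
  from gaussian_moment_1
  have "has_bochner_integral lborel (\<lambda>t. indicat_real {0..} (0 + \<eta> / 2 * t) *\<^sub>R (exp (- (0 + \<eta> / 2 * t)\<^sup>2) * (0 + \<eta> / 2 * t))) (1 / \<eta>)"
    by (subst (asm) lborel_has_bochner_integral_real_affine_iff[OF c, of _ _ 0]) (use assms in simp)
  from has_bochner_integral_mult_right[OF this, of "2 / \<eta>"]
  have *: "has_bochner_integral lborel (\<lambda>t. 2 / \<eta> * (indicat_real {0..} (0 + \<eta> / 2 * t) *\<^sub>R (exp (- (0 + \<eta> / 2 * t)\<^sup>2) * (0 + \<eta> / 2 * t)))) (2 / \<eta>\<^sup>2)"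
    by (simp add: power2_eq_square)
  show "has_bochner_integral lborel (\<lambda>t. indicator {0<..} t *\<^sub>R (t * exp (- t\<^sup>2 * \<eta>\<^sup>2 / 4))) (2 / \<eta>\<^sup>2)"
    by (rule has_bochner_integral_cong_AE[THEN iffD1, OF _ _ _ *])
       (use ind assms in \<open>auto simp: power_mult_distrib power_divide mult_ac elim!: eventually_mono\<close>)
qed

text \<open>
  From \<open>exp (- s t) \<ge> 1 - s t\<close> and the zeroth and first half-line moments of the Gaussian.
\<close>

lemma laplace_gauss_ge:
  assumes s: "0 < s" and \<xi>: "\<bar>\<xi>\<bar> \<le> \<eta>" "0 < \<eta>"
  shows "sqrt pi / \<eta> - 2 * s / \<eta>\<^sup>2 \<le> laplace_gauss \<xi> s"
proof -
  let ?E = "\<lambda>t. indicat_real {0<..} t *\<^sub>R exp (- t\<^sup>2 * \<eta>\<^sup>2 / 4)"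
  let ?T = "\<lambda>t. indicat_real {0<..} t *\<^sub>R (t * exp (- t\<^sup>2 * \<eta>\<^sup>2 / 4))"
  note g = gauss_half_line[OF \<xi>(2), unfolded has_bochner_integral_iff]
  have "sqrt pi / \<eta> - 2 * s / \<eta>\<^sup>2 = (LINT t|lborel. ?E t - s * ?T t)"
    using g by (subst Bochner_Integration.integral_diff) auto
  also have "\<dots> \<le> laplace_gauss \<xi> s"
    unfolding laplace_gauss_def set_lebesgue_integral_def
  proof (rule integral_mono)
    show "integrable lborel (\<lambda>t. ?E t - s * ?T t)" using g by auto
    show "integrable lborel (\<lambda>t. indicat_real {0<..} t *\<^sub>R exp (- s * t - t\<^sup>2 * \<xi>\<^sup>2 / 4))"
      using laplace_gauss_integrable[OF s] by (simp add: set_integrable_def)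
    fix t :: real
    have "(1 - s * t) * exp (- t\<^sup>2 * \<eta>\<^sup>2 / 4) \<le> exp (- s * t) * exp (- t\<^sup>2 * \<eta>\<^sup>2 / 4)"
      using exp_ge_add_one_self[of "- s * t"] by (intro mult_right_mono) auto
    also have "\<xi>\<^sup>2 \<le> \<eta>\<^sup>2" using \<xi> by (simp add: abs_le_square_iff[symmetric])
    then have "exp (- s * t) * exp (- t\<^sup>2 * \<eta>\<^sup>2 / 4) \<le> exp (- s * t) * exp (- t\<^sup>2 * \<xi>\<^sup>2 / 4)"
      by (intro mult_left_mono) (auto intro!: mult_left_mono)
    also have "\<dots> = exp (- s * t - t\<^sup>2 * \<xi>\<^sup>2 / 4)"
      by (simp add: exp_add[symmetric])
    finally show "?E t - s * ?T t \<le> indicat_real {0<..} t *\<^sub>R exp (- s * t - t\<^sup>2 * \<xi>\<^sup>2 / 4)"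
      by (auto simp: indicator_def algebra_simps)
  qed
  finally show ?thesis .
qed

lemma laplace_gauss_le_1: "laplace_gauss \<xi> 1 \<le> 1"
proof -
  have "laplace_gauss \<xi> 1 \<le> (LINT t:{0<..}|lborel. exp (- (t * 1)))"
    unfolding laplace_gauss_def
    by (rule set_integral_mono[OF laplace_gauss_integrable integrable_I0i_exp_mscale]) auto
  then show ?thesis
    using LBINT_I0i_exp_mscale[of 1] by (simp add: interval_lebesgue_integral_0_infty)
qed

text \<open>
  A quantitative form of strict monotonicity: the lower bound comes from \<open>t \<in> [0, 1]\<close> alone, where
  the larger exponent \<open>s' t + t\<^sup>2 \<xi>\<^sup>2 / 4\<close> is at most \<open>4\<close>.
\<close>

lemma laplace_gauss_diff_ge:
  assumes s: "0 < s" "s \<le> s'" "s' \<le> 3" and \<xi>: "\<bar>\<xi>\<bar> \<le> 2"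
  shows "(s' - s) * (exp (- 4) / 2) \<le> laplace_gauss \<xi> s - laplace_gauss \<xi> s'"
proof -
  let ?l = "\<lambda>s t. indicat_real {0<..} t *\<^sub>R exp (- s * t - t\<^sup>2 * \<xi>\<^sup>2 / 4)"
  have int: "integrable lborel (?l s)" "integrable lborel (?l s')"
    using laplace_gauss_integrable[of s] laplace_gauss_integrable[of s'] s by (auto simp: set_integrable_def)
  have unit: "has_bochner_integral lborel (\<lambda>t::real. t * indicator {0..1} t) (1\<^sup>2 / 2 - 0\<^sup>2 / 2)"
    by (rule has_bochner_integral_FTC_Icc_real) (auto intro!: derivative_eq_intros)
  have "(s' - s) * (exp (- 4) / 2) = (LINT t|lborel. (s' - s) * exp (- 4) * (t * indicator {0..1} t))"
    using has_bochner_integral_integral_eq[OF unit] by simp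
  also have "\<dots> \<le> (LINT t|lborel. ?l s t - ?l s' t)"
  proof (rule integral_mono)
    show "integrable lborel (\<lambda>t. (s' - s) * exp (- 4) * (t * indicator {0..1::real} t))"
      using has_bochner_integral_integrable unit by (intro integrable_mult_right) (auto simp: has_bochner_integral_iff)
    show "integrable lborel (\<lambda>t. ?l s t - ?l s' t)" using int by simp
    fix t :: real
    consider "t \<le> 0" | "1 < t" | "0 < t" "t \<le> 1" by linarith
    then show "(s' - s) * exp (- 4) * (t * indicator {0..1} t) \<le> ?l s t - ?l s' t"
    proof cases
      case 1 then show ?thesis by (auto simp: indicator_def)
    next
      case 2 then show ?thesis using s by (auto simp: indicator_def)
    next
      case 3
      let ?e = "exp (- s' * t - t\<^sup>2 * \<xi>\<^sup>2 / 4)"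
      have "t\<^sup>2 * \<xi>\<^sup>2 \<le> 1 * 4"
        using 3 \<xi> power_le_one[of t 2] abs_le_square_iff[of \<xi> 2] by (intro mult_mono) auto
      moreover have "s' * t \<le> 3 * 1" using s 3 by (intro mult_mono) auto
      ultimately have e: "exp (- 4) \<le> ?e" by simp
      have "(s' - s) * t * exp (- 4) \<le> (s' - s) * t * ?e"
        using s 3 e by (intro mult_left_mono) auto
      also have "(s' - s) * t \<le> exp ((s' - s) * t) - 1"
        using exp_ge_add_one_self[of "(s' - s) * t"] by linarith
      then have "(s' - s) * t * ?e \<le> (exp ((s' - s) * t) - 1) * ?e"
        by (rule mult_right_mono) simp
      also have "\<dots> = exp (- s * t - t\<^sup>2 * \<xi>\<^sup>2 / 4) - ?e"
        by (simp add: algebra_simps exp_add[symmetric])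
      finally show ?thesis using 3 by (simp add: indicator_def mult_ac)
    qed
  qed
  also have "\<dots> = laplace_gauss \<xi> s - laplace_gauss \<xi> s'"
    using int by (simp add: laplace_gauss_def set_lebesgue_integral_def)
  finally show ?thesis .
qed

lemma laplace_gauss_continuous: "continuous_on {0<..} (laplace_gauss \<xi>)"
proof -
  have "continuous_on {0<..} (\<lambda>s. Re (1 - \<omega> (complex_of_real (s - 1)) \<xi>))"
    by (intro continuous_intros continuous_on_compose2[OF holomorphic_on_imp_continuous_on[OF omega_holomorphic]])
       auto
  then show ?thesis
    by (rule continuous_on_cong[THEN iffD1, OF refl, rotated])
       (simp only: omega_eq_laplace_gauss greaterThan_iff, simp)
qed

lemma one_less_sqrt_pi: "1 < sqrt pi"
  using pi_gt3 by (simp add: real_less_rsqrt)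

lemma sqrt_pi_less_two: "sqrt pi < 2"
  using pi_less_4 by (simp add: real_less_lsqrt)

text \<open>
  The intermediate value theorem on \<open>[s\<^sub>0, 1]\<close>. The modulus of \<open>\<xi>\<close> is replaced by
  \<open>\<eta> = max \<bar>\<xi>\<bar> 1\<close>, which is still below \<open>\<surd>\<pi>\<close>, so that \<open>\<xi> = 0\<close> needs no separate treatment.
\<close>

lemma lambda_star:
  assumes "\<bar>\<xi>\<bar> < sqrt pi"
  shows "- 1 < lambda_star \<xi>" "lambda_star \<xi> \<le> 0" "\<omega> (complex_of_real (lambda_star \<xi>)) \<xi> = 0"
proof -
  define \<eta> where "\<eta> = max \<bar>\<xi>\<bar> 1"
  have \<eta>: "\<bar>\<xi>\<bar> \<le> \<eta>" "1 \<le> \<eta>" "\<eta> < sqrt pi"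
    using assms one_less_sqrt_pi by (auto simp: \<eta>_def)
  define s0 where "s0 = (sqrt pi - \<eta>) / 4"
  have s0: "0 < s0" "s0 \<le> 1"
    using \<eta> sqrt_pi_less_two by (auto simp: s0_def)
  have "2 * s0 / \<eta> \<le> 2 * s0" using \<eta> s0 by (simp add: field_simps)
  moreover have "4 * s0 = sqrt pi - \<eta>" by (simp add: s0_def)
  ultimately have "1 * \<eta> \<le> sqrt pi - 2 * s0 / \<eta>" using s0 by linarith
  then have "1 \<le> (sqrt pi - 2 * s0 / \<eta>) / \<eta>" using \<eta> by (subst pos_le_divide_eq) auto
  also have "\<dots> = sqrt pi / \<eta> - 2 * s0 / \<eta>\<^sup>2"
    by (simp add: diff_divide_distrib power2_eq_square)
  also have "\<dots> \<le> laplace_gauss \<xi> s0"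
    using laplace_gauss_ge[OF s0(1) \<eta>(1)] \<eta> by simp
  finally have "\<exists>s\<ge>s0. s \<le> 1 \<and> laplace_gauss \<xi> s = 1"
    using laplace_gauss_le_1 s0
    by (intro IVT2' continuous_on_subset[OF laplace_gauss_continuous]) auto
  then obtain s where s: "s0 \<le> s" "s \<le> 1" "laplace_gauss \<xi> s = 1" by blast
  have uniq: "x = s - 1" if "x \<in> {- 1<..0}" "\<omega> (complex_of_real x) \<xi> = 0" for x
  proof -
    have x: "0 < x + 1" "x + 1 \<le> 3" using that by auto
    have "laplace_gauss \<xi> (x + 1) = 1"
      using that(2) omega_eq_laplace_gauss[OF x(1), of \<xi>] by simp
    with s have eq: "laplace_gauss \<xi> (x + 1) = laplace_gauss \<xi> s" by simp
    have \<xi>2: "\<bar>\<xi>\<bar> \<le> 2" using assms sqrt_pi_less_two by simp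
    have "\<not> (s < x + 1 \<or> x + 1 < s)"
      using laplace_gauss_diff_ge[of s "x + 1" \<xi>] laplace_gauss_diff_ge[of "x + 1" s \<xi>] x s s0 \<xi>2 eq
      by (auto simp: mult_le_0_iff)
    then show ?thesis by linarith
  qed
  have "lambda_star \<xi> = s - 1"
    unfolding lambda_star_def
  proof (rule the_equality)
    show "s - 1 \<in> {- 1<..0} \<and> \<omega> (complex_of_real (s - 1)) \<xi> = 0"
      using s s0 omega_eq_laplace_gauss[of s \<xi>] by auto
  qed (use uniq in auto)
  then show "- 1 < lambda_star \<xi>" "lambda_star \<xi> \<le> 0" "\<omega> (complex_of_real (lambda_star \<xi>)) \<xi> = 0"
    using s s0 omega_eq_laplace_gauss[of s \<xi>] by auto
qed

lemma lambda_star_ge: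
  assumes "\<bar>\<xi>\<bar> \<le> 1"
  shows "(sqrt pi - 1) / 2 \<le> 1 + lambda_star \<xi>"
proof -
  note l = lambda_star[of \<xi>]
  have \<xi>: "\<bar>\<xi>\<bar> < sqrt pi" using assms one_less_sqrt_pi by linarith
  have "laplace_gauss \<xi> (1 + lambda_star \<xi>) = 1"
    using l[OF \<xi>] omega_eq_laplace_gauss[of "1 + lambda_star \<xi>" \<xi>] by simp
  with laplace_gauss_ge[of "1 + lambda_star \<xi>" \<xi> 1] l(1)[OF \<xi>] assms show ?thesis by simp
qed

text \<open>
  The complex derivative is the limit of real difference quotients taken from the right, each of
  which is bounded below by lemma \<open>laplace_gauss_diff_ge\<close>.
\<close>

lemma omega_deriv_ge:
  assumes \<xi>: "\<bar>\<xi>\<bar> < sqrt pi"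
    and D: "((\<lambda>z. \<omega> z \<xi>) has_field_derivative D) (at (complex_of_real (lambda_star \<xi>)))"
  shows "exp (- 4) / 2 \<le> cmod D"
proof -
  let ?\<mu> = "lambda_star \<xi>"
  note l = lambda_star[OF \<xi>]
  define x where "x = (\<lambda>n. ?\<mu> + 1 / real (Suc n))"
  have "x \<longlonglongrightarrow> ?\<mu> + 0"
    unfolding x_def by (intro tendsto_add tendsto_const LIMSEQ_inverse_real_of_nat[unfolded inverse_eq_divide])
  then have "(\<lambda>n. complex_of_real (x n)) \<longlonglongrightarrow> complex_of_real ?\<mu>"
    by (simp add: tendsto_of_real_iff)
  then have "filterlim (\<lambda>n. complex_of_real (x n)) (at (complex_of_real ?\<mu>)) sequentially"
    by (rule filterlim_atI) (rule always_eventually, simp only: of_real_eq_iff, simp add: x_def)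
  then have "(\<lambda>n. (\<omega> (complex_of_real (x n)) \<xi> - \<omega> (complex_of_real ?\<mu>) \<xi>) / (complex_of_real (x n) - complex_of_real ?\<mu>))
      \<longlonglongrightarrow> D"
    using D[unfolded has_field_derivative_iff] by (rule filterlim_compose[rotated])
  then have "(\<lambda>n. Re ((\<omega> (complex_of_real (x n)) \<xi> - \<omega> (complex_of_real ?\<mu>) \<xi>) / (complex_of_real (x n) - complex_of_real ?\<mu>)))
      \<longlonglongrightarrow> Re D"
    by (rule tendsto_Re)
  moreover have "exp (- 4) / 2 \<le> Re ((\<omega> (complex_of_real (x n)) \<xi> - \<omega> (complex_of_real ?\<mu>) \<xi>) / (complex_of_real (x n) - complex_of_real ?\<mu>))" for n
  proof -
    have xn: "?\<mu> < x n" "x n \<le> ?\<mu> + 1" by (auto simp: x_def)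
    have w1: "\<omega> (complex_of_real (x n)) \<xi> = complex_of_real (1 - laplace_gauss \<xi> (1 + x n))"
      using omega_eq_laplace_gauss[of "1 + x n" \<xi>] xn l by simp
    have w2: "\<omega> (complex_of_real ?\<mu>) \<xi> = complex_of_real (1 - laplace_gauss \<xi> (1 + ?\<mu>))"
      using omega_eq_laplace_gauss[of "1 + ?\<mu>" \<xi>] l by simp
    have "(x n - ?\<mu>) * (exp (- 4) / 2) \<le> laplace_gauss \<xi> (1 + ?\<mu>) - laplace_gauss \<xi> (1 + x n)"
      using laplace_gauss_diff_ge[of "1 + ?\<mu>" "1 + x n" \<xi>] l xn \<xi> sqrt_pi_less_two by simp
    then have "exp (- 4) / 2 \<le> (laplace_gauss \<xi> (1 + ?\<mu>) - laplace_gauss \<xi> (1 + x n)) / (x n - ?\<mu>)"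
      using xn by (simp add: pos_le_divide_eq mult.commute)
    then show ?thesis
      unfolding w1 w2 by (simp flip: of_real_diff of_real_divide)
  qed
  ultimately have "exp (- 4) / 2 \<le> Re D"
    by (intro LIMSEQ_le_const) auto
  then show ?thesis using complex_Re_le_cmod[of D] by linarith
qed

section \<open>The resolvent and the Riesz projection\<close>

lemma norm_L2w_pos:
  assumes f: "f \<in> L2w" and e: "0 < e" and nz: "\<And>v. 0 < v \<Longrightarrow> v < e \<Longrightarrow> f v \<noteq> 0"
  shows "0 < norm_L2w f"
proof (rule ccontr)
  assume "\<not> 0 < norm_L2w f"
  then have "norm_L2w f = 0"
    using norm_L2w_nonneg[of f] by linarith
  from norm_L2w_eq_0_imp[OF f this] have "AE v in lborel. v \<notin> {0<..<e}"
    by eventually_elim (use nz in auto)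
  then have "{0<..<e} \<in> null_sets lborel"
    by (subst AE_iff_null_sets) auto
  then show False
    using e by (auto simp: null_sets_def)
qed

lemma L_op_minus: "L_op \<xi> u v - z * u v = inner_w u (\<lambda>_. 1) - den \<xi> z v * u v"
  by (simp add: L_op_def den_def algebra_simps)

text \<open>
  A circle around \<open>\<lambda>*\<close> that encloses no other spectrum therefore stays in the half-plane \<open>Re \<lambda> > -1\<close>. The test
  functions are odd and supported near \<open>0\<close>: oddness kills the rank-one term of \<open>L\<^sub>\<xi>\<close>, and what
  remains, \<open>- i v \<xi> u\<close>, is small relative to \<open>u\<close>. This covers \<open>\<xi> = 0\<close> as well.
\<close>

lemma minus_one_notin_resolvent_set: "- 1 \<notin> resolvent_set \<xi>"
proof
  assume "- 1 \<in> resolvent_set \<xi>"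
  then obtain C where C: "\<And>u. u \<in> L_dom \<xi> \<Longrightarrow> norm_L2w u \<le> C * norm_L2w (\<lambda>v. L_op \<xi> u v - (- 1) * u v)"
    by (auto simp: resolvent_set_def)
  define e where "e = 1 / (2 * (\<bar>C\<bar> * \<bar>\<xi>\<bar> + 1))"
  have e: "0 < e" "\<bar>C\<bar> * (e * \<bar>\<xi>\<bar>) < 1"
    by (auto simp: e_def field_simps add_pos_nonneg add_nonneg_pos)
  define u :: "real \<Rightarrow> complex" where "u = (\<lambda>v. complex_of_real (sgn v * indicator {- e<..<e} v))"
  have u_meas: "u \<in> borel_measurable borel" unfolding u_def by measurable
  have u: "u \<in> L2w"
    by (rule L2w_dominated(1)[where g = "\<lambda>_. 1" and C = 1])
       (auto simp: u_meas, auto simp: u_def indicator_def sgn_if)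
  have "inner_w u (\<lambda>_. 1) = (LINT v|lborel. u (0 + (- 1) * v) * complex_of_real (w (0 + (- 1) * v)))"
    unfolding inner_w_def by (subst lborel_integral_real_affine[where c = "- 1" and t = 0]) auto
  also have "\<dots> = - inner_w u (\<lambda>_. 1)"
    unfolding inner_w_def integral_minus[symmetric]
    by (intro Bochner_Integration.integral_cong refl) (auto simp: u_def w_def indicator_def sgn_if)
  finally have "inner_w u (\<lambda>_. 1) = 0" by simp
  then have Lu: "L_op \<xi> u v - (- 1) * u v = - (\<i> * complex_of_real (v * \<xi>)) * u v" for v
    unfolding L_op_minus by (simp add: den_def)
  have b: "cmod (- (\<i> * complex_of_real (v * \<xi>)) * u v) \<le> (e * \<bar>\<xi>\<bar>) * cmod (u v)" for v
    using e by (auto simp: u_def indicator_def norm_mult abs_mult intro!: mult_right_mono)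
  note dom = L2w_dominated[OF u _ AE_I2[OF b]]
  have L0: "(\<lambda>v. L_op \<xi> u v - (- 1) * u v) \<in> L2w"
    unfolding Lu by (rule dom(1)) (use u_meas in measurable)
  then have "(\<lambda>v. (L_op \<xi> u v - (- 1) * u v) - u v) \<in> L2w"
    using u by (rule L2w_diff)
  then have "u \<in> L_dom \<xi>"
    using u by (simp add: L_dom_def)
  then have "norm_L2w u \<le> C * norm_L2w (\<lambda>v. L_op \<xi> u v - (- 1) * u v)" by (rule C)
  also have "\<dots> \<le> \<bar>C\<bar> * norm_L2w (\<lambda>v. L_op \<xi> u v - (- 1) * u v)"
    by (intro mult_right_mono) auto
  also have "\<dots> \<le> \<bar>C\<bar> * ((e * \<bar>\<xi>\<bar>) * norm_L2w u)"
    unfolding Lu by (intro mult_left_mono dom(2)) (use u_meas e in \<open>measurable, auto\<close>)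
  finally have "norm_L2w u \<le> \<bar>C\<bar> * (e * \<bar>\<xi>\<bar>) * norm_L2w u" by (simp add: mult_ac)
  moreover have "0 < norm_L2w u"
    by (rule norm_L2w_pos[OF u e(1)]) (use e in \<open>auto simp: u_def indicator_def\<close>)
  then have "\<bar>C\<bar> * (e * \<bar>\<xi>\<bar>) * norm_L2w u < 1 * norm_L2w u"
    using e(2) by (intro mult_strict_right_mono)
  ultimately show False by simp
qed

text \<open>
  If \<open>\<omega>(\<lambda>, \<xi>) = 0\<close>, then \<open>1 / d\<close> is an eigenfunction.
\<close>

lemma omega_nonzero_if_resolvent_set:
  assumes z: "- 1 < Re z" "z \<in> resolvent_set \<xi>"
  shows "\<omega> z \<xi> \<noteq> 0"
proof
  assume w0: "\<omega> z \<xi> = 0"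
  let ?u = "\<lambda>v. 1 / den \<xi> z v"
  have u: "?u \<in> L2w" using z(1) by (rule inverse_den_L2w)
  have "inner_w ?u (\<lambda>_. 1) = 1"
    using w0 by (simp add: omega_eq_cauchy_w cauchy_w_def inner_w_def)
  then have Lu: "L_op \<xi> ?u v - z * ?u v = 0" for v
    using L_op_minus[of \<xi> ?u v z] den_nonzero[OF z(1)] by simp
  then have "L_op \<xi> ?u = (\<lambda>v. z * ?u v)" by (simp add: fun_eq_iff)
  then have "?u \<in> L_dom \<xi>"
    using u L2w_scale[OF u, of z] by (simp add: L_dom_def)
  moreover obtain C where C: "\<And>u. u \<in> L_dom \<xi> \<Longrightarrow> norm_L2w u \<le> C * norm_L2w (\<lambda>v. L_op \<xi> u v - z * u v)"
    using z(2) by (auto simp: resolvent_set_def)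
  ultimately have "norm_L2w ?u \<le> C * norm_L2w (\<lambda>v. L_op \<xi> ?u v - z * ?u v)" by blast
  then have "norm_L2w ?u \<le> 0"
    unfolding Lu by (simp add: norm_L2w_const)
  moreover have "0 < norm_L2w ?u"
    by (rule norm_L2w_pos[OF u zero_less_one]) (use den_nonzero[OF z(1)] in auto)
  ultimately show False by simp
qed

text \<open>
  The explicit solution of \<open>(L\<^sub>\<xi> - \<lambda>) u = f\<close> for \<open>Re \<lambda> > -1\<close> and \<open>\<omega>(\<lambda>, \<xi>) \<noteq> 0\<close>. Like every resolvent, it is unique only up to equality
  almost everywhere, so it need not coincide pointwise with \<^const>\<open>resolvent\<close>.
\<close>

definition resolvent_formula :: "real \<Rightarrow> complex \<Rightarrow> (real \<Rightarrow> complex) \<Rightarrow> real \<Rightarrow> complex"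
  where "resolvent_formula \<xi> z f v = - (f v + cauchy_w \<xi> z f / \<omega> z \<xi>) * (1 / den \<xi> z v)"

lemma resolvent_formula_L2w:
  assumes f: "f \<in> L2w" and z: "- 1 < Re z"
  shows "resolvent_formula \<xi> z f \<in> L2w"
    and "norm_L2w (resolvent_formula \<xi> z f)
      \<le> 1 / (1 + Re z) * (2 * (1 + 1 / ((1 + Re z) * cmod (\<omega> z \<xi>)))) * norm_L2w f"
proof -
  let ?c = "cauchy_w \<xi> z f / \<omega> z \<xi>"
  note [measurable] = L2w_measurable[OF f]
  have g: "(\<lambda>v. f v + ?c) \<in> L2w" using f by (intro L2w_add) auto
  have b: "AE v in lborel. cmod (resolvent_formula \<xi> z f v) \<le> 1 / (1 + Re z) * cmod (f v + ?c)"
  proof (rule AE_I2)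
    fix v
    from mult_left_mono[OF cmod_inverse_den_le[OF z] norm_ge_zero]
    have "cmod (f v + ?c) * cmod (1 / den \<xi> z v) \<le> cmod (f v + ?c) * (1 / (1 + Re z))" .
    then show "cmod (resolvent_formula \<xi> z f v) \<le> 1 / (1 + Re z) * cmod (f v + ?c)"
      unfolding resolvent_formula_def norm_mult norm_minus_cancel by (simp only: mult.commute)
  qed
  have m: "resolvent_formula \<xi> z f \<in> borel_measurable borel"
    unfolding resolvent_formula_def[abs_def] by measurable
  show "resolvent_formula \<xi> z f \<in> L2w" by (rule L2w_dominated(1)[OF g m b])
  have "norm_L2w (\<lambda>v. f v + ?c) \<le> 2 * (norm_L2w f + cmod ?c)"
    using norm_L2w_add_le[OF f L2w_const[of ?c]] by (simp add: norm_L2w_const)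
  also have "cmod ?c \<le> norm_L2w f / (1 + Re z) / cmod (\<omega> z \<xi>)"
    unfolding norm_divide by (intro divide_right_mono cmod_cauchy_w_le f z) auto
  also have "2 * (norm_L2w f + norm_L2w f / (1 + Re z) / cmod (\<omega> z \<xi>))
      = 2 * (1 + 1 / ((1 + Re z) * cmod (\<omega> z \<xi>))) * norm_L2w f"
    by (simp add: algebra_simps)
  finally have "1 / (1 + Re z) * norm_L2w (\<lambda>v. f v + ?c)
      \<le> 1 / (1 + Re z) * (2 * (1 + 1 / ((1 + Re z) * cmod (\<omega> z \<xi>))) * norm_L2w f)"
    using z by (intro mult_left_mono) auto
  with L2w_dominated(2)[OF g m b] z
  show "norm_L2w (resolvent_formula \<xi> z f)
      \<le> 1 / (1 + Re z) * (2 * (1 + 1 / ((1 + Re z) * cmod (\<omega> z \<xi>)))) * norm_L2w f"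
    by (simp add: mult.assoc)
qed

lemma inner_w_resolvent_formula:
  assumes f: "f \<in> L2w" and g: "g \<in> L2w" and z: "- 1 < Re z"
  shows "inner_w (resolvent_formula \<xi> z f) g
    = - (LINT v|lborel. f v * cnj (g v) * complex_of_real (w v) / den \<xi> z v)
      - cauchy_w \<xi> z f * cauchy_w \<xi> z (\<lambda>v. cnj (g v)) / \<omega> z \<xi>"
proof -
  let ?c = "cauchy_w \<xi> z f / \<omega> z \<xi>"
  have i1: "integrable lborel (\<lambda>v. f v * cnj (g v) * complex_of_real (w v) / den \<xi> z v)"
    by (intro integrable_divide_den L2w_mult_integrable f L2w_cnj g z)
  have i2: "integrable lborel (\<lambda>v. cnj (g v) * complex_of_real (w v) / den \<xi> z v)"
    by (intro cauchy_w_integrable L2w_cnj g z)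
  have "inner_w (resolvent_formula \<xi> z f) g
    = (LINT v|lborel. - (f v * cnj (g v) * complex_of_real (w v) / den \<xi> z v)
        - ?c * (cnj (g v) * complex_of_real (w v) / den \<xi> z v))"
    unfolding inner_w_def resolvent_formula_def
    by (intro Bochner_Integration.integral_cong refl) (simp add: algebra_simps diff_divide_distrib)
  also have "\<dots> = - (LINT v|lborel. f v * cnj (g v) * complex_of_real (w v) / den \<xi> z v)
        - ?c * (LINT v|lborel. cnj (g v) * complex_of_real (w v) / den \<xi> z v)"
    using i1 integrable_mult_right[OF i2, of ?c]
    by (subst Bochner_Integration.integral_diff) (simp_all only: integral_mult_right_zero integral_minus integrable_minus)
  finally show ?thesis by (simp add: cauchy_w_def)
qed

lemma resolvent_formula_solves:
  assumes f: "f \<in> L2w" and z: "- 1 < Re z" and w0: "\<omega> z \<xi> \<noteq> 0"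
  shows "L_op \<xi> (resolvent_formula \<xi> z f) v - z * resolvent_formula \<xi> z f v = f v"
    and "resolvent_formula \<xi> z f \<in> L_dom \<xi>"
proof -
  have "inner_w (resolvent_formula \<xi> z f) (\<lambda>_. 1) = - cauchy_w \<xi> z f / \<omega> z \<xi>"
    using inner_w_resolvent_formula[OF f L2w_const[of 1] z, of \<xi>] w0
    by (simp add: omega_eq_cauchy_w cauchy_w_def[of \<xi> z f, symmetric] divide_simps) (simp add: algebra_simps)
  then show eq: "L_op \<xi> (resolvent_formula \<xi> z f) v - z * resolvent_formula \<xi> z f v = f v" for v
    unfolding L_op_minus using den_nonzero[OF z, of \<xi> v] by (simp add: resolvent_formula_def[of \<xi> z f v])
  have "L_op \<xi> (resolvent_formula \<xi> z f) = (\<lambda>v. f v + z * resolvent_formula \<xi> z f v)"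
    using eq by (simp add: fun_eq_iff algebra_simps)
  then show "resolvent_formula \<xi> z f \<in> L_dom \<xi>"
    using resolvent_formula_L2w(1)[OF f z, of \<xi>] by (simp add: L_dom_def L2w_add[OF f] L2w_scale)
qed

lemma resolvent_formula_unique:
  assumes f: "f \<in> L2w" and z: "- 1 < Re z" and w0: "\<omega> z \<xi> \<noteq> 0"
    and u: "u \<in> L_dom \<xi>" "AE v in lborel. L_op \<xi> u v - z * u v = f v"
  shows "AE v in lborel. u v = resolvent_formula \<xi> z f v"
proof -
  define c where "c = inner_w u (\<lambda>_. 1)"
  have uL: "u \<in> L2w" using u by (simp add: L_dom_def)
  have u_eq: "AE v in lborel. u v = (c * 1 + (- 1) * f v) / den \<xi> z v"
    using u(2)
  proof eventually_elim
    case (elim v)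
    then have "c - f v = den \<xi> z v * u v" unfolding L_op_minus c_def by (simp add: algebra_simps)
    then show ?case using den_nonzero[OF z, of \<xi> v] by (simp add: field_simps)
  qed
  note [measurable] = L2w_measurable[OF uL] L2w_measurable[OF f]
  have "c = (LINT v|lborel. (c * 1 + (- 1) * f v) * complex_of_real (w v) / den \<xi> z v)"
    unfolding c_def inner_w_def
    by (rule integral_cong_AE) (use u_eq in \<open>auto simp: c_def inner_w_def elim!: eventually_mono\<close>)
  also have "\<dots> = c * cauchy_w \<xi> z (\<lambda>_. 1) + (- 1) * cauchy_w \<xi> z f"
    using cauchy_w_linear[OF L2w_const[of 1] f z, of \<xi> c "- 1"] by (simp add: cauchy_w_def)
  finally have "c * \<omega> z \<xi> = - cauchy_w \<xi> z f"
    by (simp add: omega_eq_cauchy_w algebra_simps)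
  then have "c = - cauchy_w \<xi> z f / \<omega> z \<xi>" using w0 by (simp add: field_simps)
  with u_eq show ?thesis
    by (auto simp: resolvent_formula_def diff_divide_distrib elim!: eventually_mono)
qed

lemma in_resolvent_setI:
  assumes z: "- 1 < Re z" and w0: "\<omega> z \<xi> \<noteq> 0"
  shows "z \<in> resolvent_set \<xi>"
  unfolding resolvent_set_def
proof (intro CollectI conjI ballI)
  fix f assume "f \<in> L2w"
  then show "\<exists>u\<in>L_dom \<xi>. AE v in lborel. L_op \<xi> u v - z * u v = f v"
    using resolvent_formula_solves[OF _ z w0] by (intro bexI[of _ "resolvent_formula \<xi> z f"]) auto
next
  let ?C = "1 / (1 + Re z) * (2 * (1 + 1 / ((1 + Re z) * cmod (\<omega> z \<xi>))))"
  have "norm_L2w u \<le> ?C * norm_L2w (\<lambda>v. L_op \<xi> u v - z * u v)" if u: "u \<in> L_dom \<xi>" for u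
  proof -
    let ?f = "\<lambda>v. L_op \<xi> u v - z * u v"
    have uL: "u \<in> L2w" and f: "?f \<in> L2w"
      using u by (auto simp: L_dom_def intro!: L2w_diff L2w_scale)
    have "AE v in lborel. u v = resolvent_formula \<xi> z ?f v"
      by (rule resolvent_formula_unique[OF f z w0 u]) simp
    then have "AE v in lborel. cmod (u v) \<le> 1 * cmod (resolvent_formula \<xi> z ?f v)"
      by eventually_elim simp
    from L2w_dominated(2)[OF resolvent_formula_L2w(1)[OF f z] L2w_measurable[OF uL] this]
    show ?thesis using resolvent_formula_L2w(2)[OF f z, of \<xi>] by simp
  qed
  then show "\<exists>C. \<forall>u\<in>L_dom \<xi>. norm_L2w u \<le> C * norm_L2w (\<lambda>v. L_op \<xi> u v - z * u v)"
    by blast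
qed

lemma inner_w_resolvent:
  assumes f: "f \<in> L2w" and g: "g \<in> L2w" and z: "- 1 < Re z" and w0: "\<omega> z \<xi> \<noteq> 0"
  shows "inner_w (resolvent \<xi> z f) g
    = - (LINT v|lborel. f v * cnj (g v) * complex_of_real (w v) / den \<xi> z v)
      - cauchy_w \<xi> z f * cauchy_w \<xi> z (\<lambda>v. cnj (g v)) / \<omega> z \<xi>"
proof -
  have "resolvent \<xi> z f \<in> L_dom \<xi> \<and> (AE v in lborel. L_op \<xi> (resolvent \<xi> z f) v - z * resolvent \<xi> z f v = f v)"
    unfolding resolvent_def
    by (rule someI[of _ "resolvent_formula \<xi> z f"]) (use resolvent_formula_solves[OF f z w0] in auto)
  then have R: "resolvent \<xi> z f \<in> L2w" "AE v in lborel. resolvent \<xi> z f v = resolvent_formula \<xi> z f v"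
    using resolvent_formula_unique[OF f z w0] by (auto simp: L_dom_def)
  note [measurable] = L2w_measurable[OF R(1)] L2w_measurable[OF L2w_cnj[OF g]]
    L2w_measurable[OF resolvent_formula_L2w(1)[OF f z, of \<xi>]]
  have "inner_w (resolvent \<xi> z f) g = inner_w (resolvent_formula \<xi> z f) g"
    unfolding inner_w_def
    by (rule integral_cong_AE) (use R(2) in \<open>auto elim!: eventually_mono\<close>)
  then show ?thesis using inner_w_resolvent_formula[OF f g z] by simp
qed

text \<open>
  The circle is an arbitrary one that neither meets nor encloses further spectrum; the value of the integral does
  not depend on it.
\<close>

lemma resolvent_contour_integral:
  assumes \<xi>: "\<bar>\<xi>\<bar> < sqrt pi" and \<mu>: "\<mu> = complex_of_real (lambda_star \<xi>)"
    and D: "((\<lambda>z. \<omega> z \<xi>) has_field_derivative D) (at \<mu>)"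
    and r: "0 < r" "cball \<mu> r - {\<mu>} \<subseteq> resolvent_set \<xi>"
    and f: "f \<in> L2w" and g: "g \<in> L2w"
  shows "((\<lambda>z. inner_w (resolvent \<xi> z f) g) has_contour_integral
    2 * pi * \<i> * (- (cauchy_w \<xi> \<mu> f * cauchy_w \<xi> \<mu> (\<lambda>v. cnj (g v)) / D))) (circlepath \<mu> r)"
proof -
  note l = lambda_star[OF \<xi>, folded \<mu>]
  have D0: "D \<noteq> 0" using omega_deriv_ge[OF \<xi> D[unfolded \<mu>]] by auto
  define H where "H = {z::complex. - 1 < Re z}"
  have H: "open H" unfolding H_def by (rule open_halfspace_Re_gt)
  have "- 1 \<notin> cball \<mu> r - {\<mu>}"
    using r(2) minus_one_notin_resolvent_set by blast
  moreover have "\<mu> - (- 1) = complex_of_real (1 + lambda_star \<xi>)"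
    by (simp add: \<mu>)
  then have "dist \<mu> (- 1) = 1 + lambda_star \<xi>"
    unfolding dist_norm using l(1) by (simp only: norm_of_real)
  ultimately have r1: "r < 1 + lambda_star \<xi>"
    using l(1) by (auto simp: \<mu> complex_eq_iff)
  have cb: "cball \<mu> r \<subseteq> H"
  proof
    fix z assume "z \<in> cball \<mu> r"
    then have "\<bar>Re \<mu> - Re z\<bar> \<le> r"
      using abs_Re_le_cmod[of "\<mu> - z"] by (simp add: dist_norm)
    with r1 show "z \<in> H" by (simp add: \<mu> H_def)
  qed
  have nz: "\<omega> z \<xi> \<noteq> 0" if "z \<in> cball \<mu> r - {\<mu>}" for z
  proof (rule omega_nonzero_if_resolvent_set)
    show "- 1 < Re z" using that cb unfolding H_def by blast
    show "z \<in> resolvent_set \<xi>" using that r(2) by blast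
  qed
  \<comment> \<open>an open neighbourhood of the closed disc on which \<open>\<mu>\<close> is the only zero of \<open>\<omega>\<close>\<close>
  define S where "S = {z \<in> H. \<omega> z \<xi> \<noteq> 0} \<union> ball \<mu> r"
  have S: "open S" "\<mu> \<in> S" "cball \<mu> r \<subseteq> S" "S \<subseteq> H"
  proof -
    have "open (H \<inter> (\<lambda>z. \<omega> z \<xi>) -` (- {0}))"
      by (rule continuous_open_preimage[OF _ H])
         (auto simp: H_def intro: holomorphic_on_imp_continuous_on omega_holomorphic)
    then have "open {z \<in> H. \<omega> z \<xi> \<noteq> 0}" by (simp add: Int_def vimage_def)
    then show "open S" by (auto simp: S_def)
    show "\<mu> \<in> S" "cball \<mu> r \<subseteq> S" using r(1) cb nz by (auto simp: S_def)
    show "S \<subseteq> H" using cb by (auto simp: S_def)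
  qed
  have nzS: "\<omega> z \<xi> \<noteq> 0" if "z \<in> S - {\<mu>}" for z
    using that nz[of z] by (auto simp: S_def)
  define K where "K = (\<lambda>z. LINT v|lborel. f v * cnj (g v) * complex_of_real (w v) / den \<xi> z v)"
  define N where "N = (\<lambda>z. cauchy_w \<xi> z f * cauchy_w \<xi> z (\<lambda>v. cnj (g v)))"
  have K: "K holomorphic_on H"
    unfolding K_def H_def
    by (intro integral_divide_den_holomorphic L2w_mult_integrable f L2w_cnj g)
  have N: "N holomorphic_on H"
    unfolding N_def H_def
    by (intro holomorphic_on_mult cauchy_w_holomorphic f L2w_cnj g)
  have contK: "isCont h \<mu>" if "h holomorphic_on H" for h
    using holomorphic_on_imp_continuous_on[OF that] continuous_on_eq_continuous_at[OF H] S(2,4) by auto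
  let ?\<Phi> = "\<lambda>z. - K z - N z / \<omega> z \<xi>"
  have hol: "?\<Phi> holomorphic_on (S - {\<mu>})"
  proof -
    have "S - {\<mu>} \<subseteq> H" using S(4) by blast
    then show ?thesis
      using nzS by (intro holomorphic_on_diff holomorphic_on_minus holomorphic_on_divide
        holomorphic_on_subset[OF K] holomorphic_on_subset[OF N]
        holomorphic_on_subset[OF omega_holomorphic[of \<xi>, folded H_def]])
  qed
  have "residue ?\<Phi> \<mu> = - (N \<mu> / D)"
  proof (rule residue_simple'[OF S(1,2) hol])
    have "(\<lambda>z. - K z * (z - \<mu>) - N z / ((\<omega> z \<xi> - \<omega> \<mu> \<xi>) / (z - \<mu>))) \<midarrow>\<mu>\<rightarrow> - K \<mu> * (\<mu> - \<mu>) - N \<mu> / D"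
      using contK[OF K] contK[OF N] unfolding isCont_def
      by (intro tendsto_diff tendsto_mult tendsto_minus tendsto_divide tendsto_ident_at tendsto_const
        D[unfolded has_field_derivative_iff] D0)
    then show "(\<lambda>z. ?\<Phi> z * (z - \<mu>)) \<midarrow>\<mu>\<rightarrow> - (N \<mu> / D)"
      by (simp add: l(3) left_diff_distrib)
  qed
  with base_residue[OF S(1,2) r(1) hol S(3)]
  have "(?\<Phi> has_contour_integral 2 * pi * \<i> * (- (N \<mu> / D))) (circlepath \<mu> r)"
    by simp
  then show ?thesis
    unfolding N_def
  proof (rule has_contour_integral_eq)
    fix z assume "z \<in> path_image (circlepath \<mu> r)"
    then have z: "z \<in> cball \<mu> r - {\<mu>}" using r(1) by auto
    then have "- 1 < Re z" using cb by (auto simp: H_def)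
    from inner_w_resolvent[OF f g this nz[OF z]]
    show "- K z - cauchy_w \<xi> z f * cauchy_w \<xi> z (\<lambda>v. cnj (g v)) / \<omega> z \<xi> = inner_w (resolvent \<xi> z f) g"
      by (simp add: K_def)
  qed
qed

lemma ex_punctured_cball_resolvent_set:
  assumes \<xi>: "\<bar>\<xi>\<bar> < sqrt pi" and \<mu>: "\<mu> = complex_of_real (lambda_star \<xi>)"
    and D: "((\<lambda>z. \<omega> z \<xi>) has_field_derivative D) (at \<mu>)"
  shows "\<exists>r>0. cball \<mu> r - {\<mu>} \<subseteq> resolvent_set \<xi>"
proof -
  note l = lambda_star[OF \<xi>, folded \<mu>]
  have D0: "D \<noteq> 0" using omega_deriv_ge[OF \<xi> D[unfolded \<mu>]] by auto
  have "\<forall>\<^sub>F z in at \<mu>. (\<omega> z \<xi> - \<omega> \<mu> \<xi>) / (z - \<mu>) \<noteq> 0"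
    using tendsto_imp_eventually_ne[OF D[unfolded has_field_derivative_iff] D0] .
  then obtain d where d: "0 < d" "\<And>z. z \<noteq> \<mu> \<Longrightarrow> dist z \<mu> < d \<Longrightarrow> \<omega> z \<xi> \<noteq> 0"
    unfolding eventually_at by (auto simp: l(3))
  define r where "r = min d (1 + lambda_star \<xi>) / 2"
  have r: "0 < r" "r < d" "r < 1 + lambda_star \<xi>" using d l by (auto simp: r_def)
  have "z \<in> resolvent_set \<xi>" if z: "z \<in> cball \<mu> r - {\<mu>}" for z
  proof (rule in_resolvent_setI)
    have "\<bar>Re \<mu> - Re z\<bar> \<le> r"
      using abs_Re_le_cmod[of "\<mu> - z"] z by (simp add: dist_norm)
    with r show "- 1 < Re z" by (simp add: \<mu>)
    show "\<omega> z \<xi> \<noteq> 0" using z r by (intro d(2)) (auto simp: dist_commute)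
  qed
  with r show ?thesis by blast
qed

text \<open>
  The explicit function \<open>(A(f) / D) / d\<close> satisfies the condition that characterises the Riesz projection, so the
  chosen representative satisfies it too. It might do so with another radius, but the contour
  integral is the same, and the two functions have the same inner products.
\<close>

lemma P_lambda_rank_one:
  assumes \<xi>: "\<bar>\<xi>\<bar> < sqrt pi" and \<mu>: "\<mu> = complex_of_real (lambda_star \<xi>)"
  obtains D where "exp (- 4) / 2 \<le> cmod D"
    and "\<And>f. f \<in> L2w \<Longrightarrow> P_lambda \<xi> f \<in> L2w"
    and "\<And>f g. f \<in> L2w \<Longrightarrow> g \<in> L2w \<Longrightarrow>
      inner_w (P_lambda \<xi> f) g = cauchy_w \<xi> \<mu> f * cauchy_w \<xi> \<mu> (\<lambda>v. cnj (g v)) / D"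
    and "\<And>f. f \<in> L2w \<Longrightarrow> AE v in lborel. P_lambda \<xi> f v = cauchy_w \<xi> \<mu> f / D * (1 / den \<xi> \<mu> v)"
proof -
  note l = lambda_star[OF \<xi>, folded \<mu>]
  have Re_\<mu>: "- 1 < Re \<mu>" using l by (simp add: \<mu>)
  then have "(\<lambda>z. \<omega> z \<xi>) field_differentiable at \<mu>"
    by (intro holomorphic_on_imp_differentiable_at[OF omega_holomorphic open_halfspace_Re_gt]) simp
  then obtain D where D: "((\<lambda>z. \<omega> z \<xi>) has_field_derivative D) (at \<mu>)"
    by (auto simp: field_differentiable_def)
  define h where "h = (\<lambda>f v. cauchy_w \<xi> \<mu> f / D * (1 / den \<xi> \<mu> v))"
  have h: "h f \<in> L2w" for f
    unfolding h_def by (intro L2w_scale inverse_den_L2w Re_\<mu>)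
  have inner_h: "inner_w (h f) g = cauchy_w \<xi> \<mu> f * cauchy_w \<xi> \<mu> (\<lambda>v. cnj (g v)) / D" for f g
  proof -
    have "inner_w (h f) g = (LINT v|lborel. cauchy_w \<xi> \<mu> f / D * (cnj (g v) * complex_of_real (w v) / den \<xi> \<mu> v))"
      unfolding inner_w_def h_def by (intro Bochner_Integration.integral_cong refl) simp
    then show ?thesis unfolding integral_mult_right_zero by (simp add: cauchy_w_def)
  qed
  have P: "P_lambda \<xi> f \<in> L2w \<and> (\<forall>g\<in>L2w. inner_w (P_lambda \<xi> f) g = inner_w (h f) g)" if f: "f \<in> L2w" for f
  proof -
    let ?Q = "\<lambda>h. h \<in> L2w \<and> (\<exists>r>0. cball \<mu> r - {\<mu>} \<subseteq> resolvent_set \<xi> \<and>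
        (\<forall>g\<in>L2w. \<exists>I. ((\<lambda>z. inner_w (resolvent \<xi> z f) g) has_contour_integral I) (circlepath \<mu> r) \<and>
           inner_w h g = - I / (2 * complex_of_real pi * \<i>)))"
    have "?Q (h f)"
    proof -
      obtain r where r: "0 < r" "cball \<mu> r - {\<mu>} \<subseteq> resolvent_set \<xi>"
        using ex_punctured_cball_resolvent_set[OF \<xi> \<mu> D] by blast
      have "\<exists>I. ((\<lambda>z. inner_w (resolvent \<xi> z f) g) has_contour_integral I) (circlepath \<mu> r) \<and>
           inner_w (h f) g = - I / (2 * complex_of_real pi * \<i>)" if g: "g \<in> L2w" for g
        using resolvent_contour_integral[OF \<xi> \<mu> D r f g] by (intro exI conjI) (auto simp: inner_h)
      with r h show ?thesis by blast
    qed
    moreover have "P_lambda \<xi> f = (SOME h. ?Q h)"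
      using \<xi> by (simp add: P_lambda_def riesz_projection_def \<mu>)
    ultimately have "?Q (P_lambda \<xi> f)"
      using someI[of ?Q "h f"] by (simp only:)
    then obtain r where PL: "P_lambda \<xi> f \<in> L2w" and r: "0 < r" "cball \<mu> r - {\<mu>} \<subseteq> resolvent_set \<xi>"
      and I: "\<And>g. g \<in> L2w \<Longrightarrow> \<exists>I. ((\<lambda>z. inner_w (resolvent \<xi> z f) g) has_contour_integral I) (circlepath \<mu> r) \<and>
           inner_w (P_lambda \<xi> f) g = - I / (2 * complex_of_real pi * \<i>)"
      by blast
    have "inner_w (P_lambda \<xi> f) g = inner_w (h f) g" if g: "g \<in> L2w" for g
    proof -
      obtain I' where I': "((\<lambda>z. inner_w (resolvent \<xi> z f) g) has_contour_integral I') (circlepath \<mu> r)"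
        "inner_w (P_lambda \<xi> f) g = - I' / (2 * complex_of_real pi * \<i>)"
        using I[OF g] by blast
      show ?thesis
        using has_contour_integral_unique[OF I'(1) resolvent_contour_integral[OF \<xi> \<mu> D r f g]] I'(2)
        by (simp add: inner_h)
    qed
    with PL show ?thesis by blast
  qed
  show thesis
  proof (rule that[of D])
    show "exp (- 4) / 2 \<le> cmod D" by (rule omega_deriv_ge[OF \<xi> D[unfolded \<mu>]])
    show "AE v in lborel. P_lambda \<xi> f v = cauchy_w \<xi> \<mu> f / D * (1 / den \<xi> \<mu> v)" if f: "f \<in> L2w" for f
      using L2w_eq_if_inner_eq[of "P_lambda \<xi> f" "h f"] P[OF f] h by (simp add: h_def)
  qed (use P in \<open>auto simp: inner_h\<close>)
qed

section \<open>Integration by parts against analytic functions\<close>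

text \<open>
  \<open>times_differentiable n f\<close>: the function has derivatives up to order \<open>n + 1\<close> everywhere. The recursion
  on the derivative, rather than on the order of an iterated derivative, makes the closure
  properties direct inductions.
\<close>

fun times_differentiable :: "nat \<Rightarrow> (real \<Rightarrow> real) \<Rightarrow> bool"
  where
    "times_differentiable 0 f \<longleftrightarrow> (\<forall>x. f differentiable (at x))"
  | "times_differentiable (Suc n) f \<longleftrightarrow> (\<forall>x. f differentiable (at x)) \<and> times_differentiable n (deriv f)"

text \<open>
  Infinitely differentiable real functions of one real variable; lemma \<open>smooth_iff\<close> below gives the
  form used for test functions.
\<close>

definition smooth :: "(real \<Rightarrow> real) \<Rightarrow> bool"
  where "smooth f \<longleftrightarrow> (\<forall>n. times_differentiable n f)"

lemma times_differentiable_imp_differentiable: "times_differentiable n f \<Longrightarrow> f differentiable (at x)"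
  by (cases n) auto

lemma smooth_iff: "smooth f \<longleftrightarrow> (\<forall>n x. (deriv ^^ n) f differentiable (at x))"
proof -
  have "times_differentiable n f \<longleftrightarrow> (\<forall>k\<le>n. \<forall>x. (deriv ^^ k) f differentiable (at x))" for n
  proof (induction n arbitrary: f)
    case (Suc n)
    have "(\<forall>k\<le>Suc n. P k) \<longleftrightarrow> P 0 \<and> (\<forall>k\<le>n. P (Suc k))" for P
      by (metis Suc_le_mono le0 not0_implies_Suc)
    with Suc show ?case
      by (simp add: funpow_Suc_right del: funpow.simps(2))
  qed simp
  then show ?thesis by (auto simp: smooth_def)
qed

lemma real_differentiable_DERIV: "f differentiable (at x) \<Longrightarrow> DERIV f x :> deriv f x" for f :: "real \<Rightarrow> real"
  using DERIV_deriv_iff_real_differentiable by blast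

lemma smooth_DERIV: "smooth f \<Longrightarrow> DERIV f x :> deriv f x"
  using times_differentiable_imp_differentiable[of 0 f x] real_differentiable_DERIV by (simp add: smooth_def)

lemma times_differentiable_Suc_imp: "times_differentiable (Suc n) f \<Longrightarrow> times_differentiable n f"
  by (induction n arbitrary: f) auto

lemma times_differentiable_add:
  "times_differentiable n f \<Longrightarrow> times_differentiable n g \<Longrightarrow> times_differentiable n (\<lambda>x. f x + g x)"
proof (induction n arbitrary: f g)
  case (Suc n)
  then have "deriv (\<lambda>x. f x + g x) = (\<lambda>x. deriv f x + deriv g x)"
    by (intro ext DERIV_imp_deriv DERIV_add real_differentiable_DERIV) auto
  moreover have "times_differentiable n (\<lambda>x. deriv f x + deriv g x)"
    using Suc.prems by (intro Suc.IH) simp_all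
  ultimately show ?case using Suc.prems by (simp add: differentiable_add)
qed (simp add: differentiable_add)

lemma times_differentiable_mult:
  "times_differentiable n f \<Longrightarrow> times_differentiable n g \<Longrightarrow> times_differentiable n (\<lambda>x. f x * g x)"
proof (induction n arbitrary: f g)
  case (Suc n)
  then have "deriv (\<lambda>x. f x * g x) = (\<lambda>x. deriv f x * g x + deriv g x * f x)"
    by (intro ext DERIV_imp_deriv DERIV_mult real_differentiable_DERIV) auto
  moreover have "times_differentiable n (\<lambda>x. deriv f x * g x + deriv g x * f x)"
    using Suc.prems times_differentiable_Suc_imp[OF Suc.prems(1)] times_differentiable_Suc_imp[OF Suc.prems(2)]
    by (intro times_differentiable_add Suc.IH) simp_all
  ultimately show ?case using Suc.prems by (simp add: differentiable_mult)
qed (simp add: differentiable_mult)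

lemma smooth_mult: "smooth f \<Longrightarrow> smooth g \<Longrightarrow> smooth (\<lambda>x. f x * g x)"
  by (simp add: smooth_def times_differentiable_mult)

lemma smooth_const: "smooth (\<lambda>_. c)"
proof -
  have "deriv (\<lambda>_. c) = (\<lambda>_. 0)" for c :: real
    by (intro ext DERIV_imp_deriv) auto
  then have "times_differentiable n (\<lambda>_. c)" for n and c :: real
    by (induction n arbitrary: c) simp_all
  then show ?thesis by (simp add: smooth_def)
qed

lemma smooth_affine:
  assumes "smooth f"
  shows "smooth (\<lambda>x. f (a * x + b))"
proof -
  have D: "DERIV (\<lambda>x. f (a * x + b)) x :> a * deriv f (a * x + b)"
    if "times_differentiable n f" for n f x
  proof -
    have "DERIV f (a * x + b) :> deriv f (a * x + b)"
      using that by (intro real_differentiable_DERIV times_differentiable_imp_differentiable)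
    moreover have "DERIV (\<lambda>x. a * x + b) x :> a"
      by (auto intro!: derivative_eq_intros)
    ultimately show ?thesis using DERIV_chain2 by (metis mult.commute)
  qed
  have "times_differentiable n f \<Longrightarrow> times_differentiable n (\<lambda>x. f (a * x + b))" for n
  proof (induction n arbitrary: f)
    case 0
    from D[OF 0] show ?case by (auto simp: real_differentiable_def)
  next
    case (Suc n)
    have "deriv (\<lambda>x. f (a * x + b)) = (\<lambda>x. a * deriv f (a * x + b))"
      by (intro ext DERIV_imp_deriv D[OF Suc.prems])
    moreover have "times_differentiable n (\<lambda>x. a * deriv f (a * x + b))"
      using Suc smooth_const[of a] by (intro times_differentiable_mult) (auto simp: smooth_def)
    ultimately show ?case using D[OF Suc.prems] by (auto simp: real_differentiable_def)
  qed
  with assms show ?thesis by (simp add: smooth_def)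
qed

lemma smooth_Re_holomorphic:
  assumes F: "F holomorphic_on S" "open S" "\<And>x. complex_of_real x \<in> S"
  shows "smooth (\<lambda>x. Re (F (complex_of_real x)))"
    and "DERIV (\<lambda>x. Re (F (complex_of_real x))) x :> Re (deriv F (complex_of_real x))"
proof -
  have D: "DERIV (\<lambda>x. Re (F (complex_of_real x))) x :> Re (deriv F (complex_of_real x))"
    if "F holomorphic_on S" for F x
  proof -
    have "(F has_field_derivative deriv F (complex_of_real x)) (at (complex_of_real x))"
      using holomorphic_derivI[OF that F(2,3)] .
    from has_vector_derivative_real_field[OF this]
    have "((\<lambda>x. F (complex_of_real x)) has_vector_derivative deriv F (complex_of_real x)) (at x)" .
    from bounded_linear.has_vector_derivative[OF bounded_linear_Re this]
    show ?thesis by (simp add: has_real_derivative_iff_has_vector_derivative)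
  qed
  have "times_differentiable n (\<lambda>x. Re (F (complex_of_real x)))" if "F holomorphic_on S" for n F
    using that
  proof (induction n arbitrary: F)
    case 0
    then show ?case using D[of F] by (auto simp: real_differentiable_def)
  next
    case (Suc n)
    then have "deriv (\<lambda>x. Re (F (complex_of_real x))) = (\<lambda>x. Re (deriv F (complex_of_real x)))"
      using D by (intro ext DERIV_imp_deriv) auto
    with Suc D[of F] holomorphic_deriv[OF Suc.prems F(2)] show ?case
      by (auto simp: real_differentiable_def)
  qed
  with F(1) show "smooth (\<lambda>x. Re (F (complex_of_real x)))" by (simp add: smooth_def)
  show "DERIV (\<lambda>x. Re (F (complex_of_real x))) x :> Re (deriv F (complex_of_real x))"
    by (rule D[OF F(1)])
qed

subsection \<open>A smooth cutoff\<close>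

text \<open>
  The functions \<open>p(1/x) exp (- 1/x)\<close> for \<open>x > 0\<close>, extended by \<open>0\<close>. The family, indexed by polynomials
  \<open>p\<close>, is closed under differentiation, so all its members are smooth.
\<close>

definition flat_exp :: "real poly \<Rightarrow> real \<Rightarrow> real"
  where "flat_exp p x = (if 0 < x then poly p (1 / x) * exp (- (1 / x)) else 0)"

lemma poly_exp_tendsto_0: "((\<lambda>u. poly p u * exp (- u)) \<longlongrightarrow> 0) at_top" for p :: "real poly"
proof -
  have "((\<lambda>u. \<Sum>i\<le>degree p. coeff p i * (u ^ i / exp u)) \<longlongrightarrow> (\<Sum>i\<le>degree p. coeff p i * 0)) at_top"
    by (intro tendsto_intros tendsto_power_div_exp_0)
  then show ?thesis
    by (simp add: poly_altdef sum_distrib_right exp_minus field_simps sum_divide_distrib)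
qed

lemma flat_exp_DERIV: "DERIV (flat_exp p) x :> flat_exp (monom 1 2 * (p - pderiv p)) x"
proof -
  let ?q = "monom 1 2 * (p - pderiv p)"
  consider "0 < x" | "x < 0" | "x = 0" by linarith
  then show ?thesis
  proof cases
    case 1
    have "DERIV (\<lambda>x. poly p (1 / x) * exp (- (1 / x))) x :> flat_exp ?q x"
      using 1 by (auto intro!: derivative_eq_intros simp: flat_exp_def poly_monom power2_eq_square field_simps)
    then show ?thesis
      by (rule has_field_derivative_transform_within_open[of _ _ _ "{0<..}"]) (use 1 in \<open>auto simp: flat_exp_def\<close>)
  next
    case 2
    have "DERIV (\<lambda>_. 0) x :> flat_exp ?q x"
      using 2 by (simp add: flat_exp_def)
    then show ?thesis
      by (rule has_field_derivative_transform_within_open[of _ _ _ "{..<0}"]) (use 2 in \<open>auto simp: flat_exp_def\<close>)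
  next
    case 3
    have "((\<lambda>y. (flat_exp p y - flat_exp p 0) / (y - 0)) \<longlongrightarrow> 0) (at_right 0)"
    proof (rule Lim_transform_eventually)
      show "((\<lambda>y. poly (pCons 0 p) (inverse y) * exp (- inverse y)) \<longlongrightarrow> 0) (at_right 0)"
        by (rule filterlim_compose[OF poly_exp_tendsto_0 filterlim_inverse_at_top_right])
      show "\<forall>\<^sub>F y in at_right 0. poly (pCons 0 p) (inverse y) * exp (- inverse y) = (flat_exp p y - flat_exp p 0) / (y - 0)"
        using eventually_at_right_less by eventually_elim (simp add: flat_exp_def divide_inverse)
    qed
    moreover have "((\<lambda>y. (flat_exp p y - flat_exp p 0) / (y - 0)) \<longlongrightarrow> 0) (at_left 0)"
    proof (rule Lim_transform_eventually)
      show "\<forall>\<^sub>F y in at_left 0. 0 = (flat_exp p y - flat_exp p 0) / (y - 0)"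
        using eventually_at_left_real[of "- 1" 0] by (auto simp: flat_exp_def elim!: eventually_mono)
    qed simp
    ultimately have "((\<lambda>y. (flat_exp p y - flat_exp p 0) / (y - 0)) \<longlongrightarrow> 0) (at 0)"
      by (rule filterlim_split_at[rotated])
    then show ?thesis using 3 by (simp add: has_field_derivative_iff flat_exp_def)
  qed
qed

lemma smooth_flat_exp: "smooth (flat_exp p)"
proof -
  have "deriv (flat_exp p) = flat_exp (monom 1 2 * (p - pderiv p))" for p
    by (intro ext DERIV_imp_deriv flat_exp_DERIV)
  moreover have "flat_exp p differentiable (at x)" for p x
    using flat_exp_DERIV real_differentiable_def by blast
  ultimately have "times_differentiable n (flat_exp p)" for n p
    by (induction n arbitrary: p) simp_all
  then show ?thesis by (simp add: smooth_def)
qed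

text \<open>
  A smooth function supported in \<open>[-1, 1]\<close>, normalised by \<open>bump 0 = 1\<close>. It need not be constant near \<open>0\<close>:
  the dilations \<open>bump (a x)\<close> converge pointwise to \<open>1\<close> as \<open>a \<rightarrow> 0\<close>, which is all that a cutoff has to do
  here. The affine arguments are spelled out for use with lemma \<open>smooth_affine\<close>.
\<close>

definition bump :: "real \<Rightarrow> real"
  where "bump x = exp 2 * (flat_exp 1 (1 * x + 1) * flat_exp 1 (- 1 * x + 1))"

lemma smooth_bump: "smooth bump"
  unfolding bump_def[abs_def] by (intro smooth_mult smooth_const smooth_affine smooth_flat_exp)

lemma bump_0: "bump 0 = 1"
  by (simp add: bump_def flat_exp_def exp_add[symmetric])

lemma bump_eq_0: "1 < \<bar>x\<bar> \<Longrightarrow> bump x = 0"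
  by (auto simp: bump_def flat_exp_def)

lemma smooth_deriv: "smooth f \<Longrightarrow> smooth (deriv f)"
  unfolding smooth_def by (metis times_differentiable.simps(2))

lemma smooth_continuous_on: "smooth f \<Longrightarrow> continuous_on S f"
  using smooth_DERIV DERIV_isCont continuous_at_imp_continuous_on by blast

lemma bump_bounded: "\<exists>M\<ge>0. \<forall>x. \<bar>bump x\<bar> \<le> M \<and> \<bar>deriv bump x\<bar> \<le> M"
proof -
  have deriv0: "deriv bump x = 0" if "1 < \<bar>x\<bar>" for x
  proof (rule DERIV_imp_deriv)
    have "DERIV (\<lambda>_. 0) x :> 0" by simp
    then show "DERIV bump x :> 0"
    proof (rule has_field_derivative_transform_within_open[of _ _ _ "{x. 1 < \<bar>x\<bar>}"])
      show "open {x::real. 1 < \<bar>x\<bar>}" by (intro open_Collect_less continuous_intros)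
    qed (use that in \<open>auto simp: bump_eq_0\<close>)
  qed
  have "bounded (f ` {- 1..1})" if "smooth f" for f
    by (intro compact_imp_bounded compact_continuous_image smooth_continuous_on that) auto
  then have bd: "\<exists>a. \<forall>x\<in>{- 1..1}. \<bar>f x\<bar> \<le> a" if "smooth f" for f
    using that unfolding bounded_iff by auto
  obtain a b where ab: "\<forall>x\<in>{- 1..1}. \<bar>bump x\<bar> \<le> a" "\<forall>x\<in>{- 1..1}. \<bar>deriv bump x\<bar> \<le> b"
    using bd[OF smooth_bump] bd[OF smooth_deriv[OF smooth_bump]] by blast
  have "\<bar>bump x\<bar> \<le> max 0 (max a b) \<and> \<bar>deriv bump x\<bar> \<le> max 0 (max a b)" for x
  proof (cases "1 < \<bar>x\<bar>")
    case True
    then show ?thesis by (simp add: bump_eq_0 deriv0)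
  next
    case False
    then have "x \<in> {- 1..1}" by auto
    with ab have "\<bar>bump x\<bar> \<le> a" "\<bar>deriv bump x\<bar> \<le> b" by blast+
    then show ?thesis by linarith
  qed
  then show ?thesis by (intro exI[of _ "max 0 (max a b)"]) auto
qed

text \<open>
  The weak derivative may be tested against smooth functions without compact support, as long as
  the integrals converge: multiply by the cutoffs \<open>bump (a\<^sub>n v)\<close> with \<open>a\<^sub>n \<rightarrow> 0\<close>, and let \<open>n \<rightarrow> \<infinity>\<close> by dominated
  convergence.
\<close>

lemma has_weak_deriv_smooth:
  assumes wd: "has_weak_deriv f f'" and \<phi>: "smooth \<phi>"
    and [measurable]: "f \<in> borel_measurable borel" "f' \<in> borel_measurable borel"
    and i0: "integrable lborel (\<lambda>v. f v * complex_of_real (\<phi> v))"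
    and i1: "integrable lborel (\<lambda>v. f v * complex_of_real (deriv \<phi> v))"
    and i2: "integrable lborel (\<lambda>v. f' v * complex_of_real (\<phi> v))"
  shows "(LINT v|lborel. f v * complex_of_real (deriv \<phi> v)) = - (LINT v|lborel. f' v * complex_of_real (\<phi> v))"
proof -
  obtain M where M: "0 \<le> M" "\<And>x. \<bar>bump x\<bar> \<le> M" "\<And>x. \<bar>deriv bump x\<bar> \<le> M"
    using bump_bounded by blast
  have [measurable]: "\<phi> \<in> borel_measurable borel" "deriv \<phi> \<in> borel_measurable borel"
    "bump \<in> borel_measurable borel" "deriv bump \<in> borel_measurable borel"
    using \<phi> smooth_bump smooth_deriv by (auto intro!: borel_measurable_continuous_onI smooth_continuous_on)
  define a where "a = (\<lambda>n. 1 / real (Suc n))"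
  have a: "0 < a n" "a n \<le> 1" for n by (auto simp: a_def)
  have a_lim: "a \<longlonglongrightarrow> 0"
    unfolding a_def using LIMSEQ_inverse_real_of_nat by (simp add: inverse_eq_divide)
  define cut where "cut = (\<lambda>n v. bump (a n * v + 0))"
  define cut' where "cut' = (\<lambda>n v. a n * deriv bump (a n * v + 0))"
  have Dcut: "DERIV (cut n) v :> cut' n v" for n v
  proof -
    have "DERIV (\<lambda>v. a n * v + 0) v :> a n" by (auto intro!: derivative_eq_intros)
    from DERIV_chain2[OF smooth_DERIV[OF smooth_bump] this]
    show ?thesis by (simp add: cut_def cut'_def mult.commute)
  qed
  have [measurable]: "cut n \<in> borel_measurable borel" "cut' n \<in> borel_measurable borel" for n
    unfolding cut_def cut'_def by measurable
  have cut_bd: "\<bar>cut n v\<bar> \<le> M" "\<bar>cut' n v\<bar> \<le> M" for n v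
  proof -
    show "\<bar>cut n v\<bar> \<le> M" by (simp only: cut_def M)
    have "a n * \<bar>deriv bump (a n * v + 0)\<bar> \<le> 1 * M"
      using a[of n] M by (intro mult_mono) (auto simp del: add_0_right)
    then show "\<bar>cut' n v\<bar> \<le> M" using a(1)[of n] by (simp add: cut'_def abs_mult)
  qed
  have cut_lim: "(\<lambda>n. cut n v) \<longlonglongrightarrow> 1" for v
  proof -
    have "(\<lambda>n. a n * v + 0) \<longlonglongrightarrow> 0 * v + 0" by (intro tendsto_intros a_lim)
    moreover have "isCont bump 0" using smooth_DERIV[OF smooth_bump] DERIV_isCont by blast
    ultimately have "(\<lambda>n. bump (a n * v + 0)) \<longlonglongrightarrow> bump 0"
      by (intro isCont_tendsto_compose[of 0 bump]) simp_all
    then show ?thesis by (simp add: cut_def bump_0)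
  qed
  have cut'_lim: "(\<lambda>n. cut' n v) \<longlonglongrightarrow> 0" for v
  proof (rule Lim_null_comparison)
    show "\<forall>\<^sub>F n in sequentially. norm (cut' n v) \<le> a n * M"
    proof (rule always_eventually, rule allI)
      fix n
      show "norm (cut' n v) \<le> a n * M"
        unfolding cut'_def real_norm_def abs_mult abs_of_pos[OF a(1)]
        by (intro mult_left_mono M less_imp_le[OF a(1)])
    qed
    show "(\<lambda>n. a n * M) \<longlonglongrightarrow> 0" using tendsto_mult_right[OF a_lim, of M] by (simp add: tendsto_mult_left_zero a_lim)
  qed
  have eq: "(LINT v|lborel. f v * complex_of_real (deriv \<phi> v * cut n v + cut' n v * \<phi> v))
      = - (LINT v|lborel. f' v * complex_of_real (\<phi> v * cut n v))" for n
  proof -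
    have "smooth (\<lambda>v. \<phi> v * cut n v)"
      unfolding cut_def by (intro smooth_mult \<phi> smooth_affine smooth_bump)
    moreover have "\<phi> x * cut n x = 0" if "real (Suc n) < \<bar>x\<bar>" for x
      using that by (simp add: cut_def bump_eq_0 a_def)
    ultimately have "test_function (\<lambda>v. \<phi> v * cut n v)"
      unfolding test_function_def smooth_iff by blast
    moreover have "deriv (\<lambda>v. \<phi> v * cut n v) = (\<lambda>v. deriv \<phi> v * cut n v + cut' n v * \<phi> v)"
      by (intro ext DERIV_imp_deriv DERIV_mult smooth_DERIV \<phi> Dcut)
    ultimately show ?thesis using wd unfolding has_weak_deriv_def by metis
  qed
  have "(\<lambda>n. LINT v|lborel. f v * complex_of_real (deriv \<phi> v * cut n v + cut' n v * \<phi> v))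
      \<longlonglongrightarrow> (LINT v|lborel. f v * complex_of_real (deriv \<phi> v * 1 + 0 * \<phi> v))"
  proof (rule integral_dominated_convergence)
    show "integrable lborel (\<lambda>v. M * cmod (f v * complex_of_real (deriv \<phi> v)) + M * cmod (f v * complex_of_real (\<phi> v)))"
      using i0 i1 by (intro Bochner_Integration.integrable_add integrable_mult_right integrable_norm)
    show "AE v in lborel. norm (f v * complex_of_real (deriv \<phi> v * cut n v + cut' n v * \<phi> v))
      \<le> M * cmod (f v * complex_of_real (deriv \<phi> v)) + M * cmod (f v * complex_of_real (\<phi> v))" for n
    proof (rule AE_I2)
      fix v
      have "\<bar>deriv \<phi> v * cut n v + cut' n v * \<phi> v\<bar> \<le> \<bar>deriv \<phi> v\<bar> * M + M * \<bar>\<phi> v\<bar>"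
        by (intro order_trans[OF abs_triangle_ineq] add_mono)
           (auto simp: abs_mult intro!: mult_left_mono mult_right_mono cut_bd)
      from mult_left_mono[OF this norm_ge_zero[of "f v"]]
      show "norm (f v * complex_of_real (deriv \<phi> v * cut n v + cut' n v * \<phi> v))
        \<le> M * cmod (f v * complex_of_real (deriv \<phi> v)) + M * cmod (f v * complex_of_real (\<phi> v))"
        unfolding norm_mult norm_of_real by (simp add: algebra_simps)
    qed
    show "AE v in lborel. (\<lambda>n. f v * complex_of_real (deriv \<phi> v * cut n v + cut' n v * \<phi> v))
      \<longlonglongrightarrow> f v * complex_of_real (deriv \<phi> v * 1 + 0 * \<phi> v)"
      by (intro AE_I2 tendsto_intros cut_lim cut'_lim)
  qed measurable
  moreover have "(\<lambda>n. - (LINT v|lborel. f' v * complex_of_real (\<phi> v * cut n v)))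
      \<longlonglongrightarrow> - (LINT v|lborel. f' v * complex_of_real (\<phi> v * 1))"
  proof (intro tendsto_minus integral_dominated_convergence)
    show "integrable lborel (\<lambda>v. M * cmod (f' v * complex_of_real (\<phi> v)))"
      using i2 by (intro integrable_mult_right integrable_norm)
    show "AE v in lborel. norm (f' v * complex_of_real (\<phi> v * cut n v)) \<le> M * cmod (f' v * complex_of_real (\<phi> v))" for n
    proof (rule AE_I2)
      fix v
      show "norm (f' v * complex_of_real (\<phi> v * cut n v)) \<le> M * cmod (f' v * complex_of_real (\<phi> v))"
        using mult_left_mono[OF cut_bd(1)[of n v], of "cmod (f' v) * \<bar>\<phi> v\<bar>"]
        by (simp add: norm_mult abs_mult mult_ac)
    qed
    show "AE v in lborel. (\<lambda>n. f' v * complex_of_real (\<phi> v * cut n v)) \<longlonglongrightarrow> f' v * complex_of_real (\<phi> v * 1)"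
      by (intro AE_I2 tendsto_intros cut_lim)
  qed measurable
  ultimately show ?thesis
    unfolding eq by (auto dest: LIMSEQ_unique)
qed

text \<open>
  Integration by parts against the restriction to the real line of a holomorphic function, by
  treating its real and imaginary parts separately; the imaginary part of \<open>F\<close> is the real part of
  \<open>- i F\<close>.
\<close>

lemma has_weak_deriv_holomorphic:
  assumes wd: "has_weak_deriv f f'"
    and [measurable]: "f \<in> borel_measurable borel" "f' \<in> borel_measurable borel"
    and F: "F holomorphic_on S" "open S" "\<And>x. complex_of_real x \<in> S"
    and i0: "integrable lborel (\<lambda>v. f v * F (complex_of_real v))"
    and i1: "integrable lborel (\<lambda>v. f v * deriv F (complex_of_real v))"
    and i2: "integrable lborel (\<lambda>v. f' v * F (complex_of_real v))"
  shows "(LINT v|lborel. f v * deriv F (complex_of_real v)) = - (LINT v|lborel. f' v * F (complex_of_real v))"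
proof -
  have meas: "(\<lambda>x. G (complex_of_real x)) \<in> borel_measurable borel" if "G holomorphic_on S" for G
    using F(3) by (intro borel_measurable_continuous_onI
      continuous_on_compose2[OF holomorphic_on_imp_continuous_on[OF that]] continuous_intros) auto
  note [measurable] = meas[OF F(1)] meas[OF holomorphic_deriv[OF F(1,2)]]
  have bound_int: "integrable lborel (\<lambda>v. g v * complex_of_real (r v))"
    if "integrable lborel (\<lambda>v. g v * G v)" "\<And>v. \<bar>r v\<bar> \<le> cmod (G v)"
      "(\<lambda>v. g v * complex_of_real (r v)) \<in> borel_measurable lborel" for g r and G :: "real \<Rightarrow> complex"
    by (rule Bochner_Integration.integrable_bound[OF that(1,3)])
       (use that(2) in \<open>auto simp: norm_mult intro!: mult_left_mono\<close>)
  have Re_int: "integrable lborel (\<lambda>v. g v * complex_of_real (Re (G (complex_of_real v))))"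
    "integrable lborel (\<lambda>v. g v * complex_of_real (Im (G (complex_of_real v))))"
    if "integrable lborel (\<lambda>v. g v * G (complex_of_real v))"
      "g \<in> borel_measurable borel" "(\<lambda>v. G (complex_of_real v)) \<in> borel_measurable borel" for g G
    by (rule bound_int[OF that(1)]; use that(2,3) in \<open>auto simp: abs_Re_le_cmod abs_Im_le_cmod\<close>)+
  have split: "(LINT v|lborel. g v * G (complex_of_real v))
    = (LINT v|lborel. g v * complex_of_real (Re (G (complex_of_real v))))
      + \<i> * (LINT v|lborel. g v * complex_of_real (Im (G (complex_of_real v))))"
    if "integrable lborel (\<lambda>v. g v * G (complex_of_real v))"
      "g \<in> borel_measurable borel" "(\<lambda>v. G (complex_of_real v)) \<in> borel_measurable borel" for g G
  proof -
    have "g v * G (complex_of_real v) = g v * complex_of_real (Re (G (complex_of_real v)))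
      + \<i> * (g v * complex_of_real (Im (G (complex_of_real v))))" for v
      using complex_eq[of "G (complex_of_real v)"] by (metis (no_types, lifting) distrib_left mult.left_commute)
    then have "(LINT v|lborel. g v * G (complex_of_real v))
      = (LINT v|lborel. g v * complex_of_real (Re (G (complex_of_real v)))
      + \<i> * (g v * complex_of_real (Im (G (complex_of_real v)))))" by simp
    also have "\<dots> = (LINT v|lborel. g v * complex_of_real (Re (G (complex_of_real v))))
      + (LINT v|lborel. \<i> * (g v * complex_of_real (Im (G (complex_of_real v)))))"
      by (intro Bochner_Integration.integral_add Re_int that integrable_mult_right)
    finally show ?thesis by simp
  qed
  note re = smooth_Re_holomorphic[OF F]
  have dre: "deriv (\<lambda>x. Re (F (complex_of_real x))) = (\<lambda>x. Re (deriv F (complex_of_real x)))"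
    by (intro ext DERIV_imp_deriv re(2))
  have hi: "(\<lambda>z. - \<i> * F z) holomorphic_on S" by (intro holomorphic_intros F)
  have di: "deriv (\<lambda>z. - \<i> * F z) (complex_of_real x) = - \<i> * deriv F (complex_of_real x)" for x
    by (intro DERIV_imp_deriv DERIV_cmult holomorphic_derivI[OF F])
  note im = smooth_Re_holomorphic[OF hi F(2,3), unfolded di, simplified]
  have dim: "deriv (\<lambda>x. Im (F (complex_of_real x))) = (\<lambda>x. Im (deriv F (complex_of_real x)))"
    by (intro ext DERIV_imp_deriv im(2))
  have "(LINT v|lborel. f v * complex_of_real (Re (deriv F (complex_of_real v))))
      = - (LINT v|lborel. f' v * complex_of_real (Re (F (complex_of_real v))))"
    using has_weak_deriv_smooth[OF wd re(1)] Re_int(1)[OF i0] Re_int(1)[OF i1] Re_int(1)[OF i2]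
    unfolding dre by simp
  moreover have "(LINT v|lborel. f v * complex_of_real (Im (deriv F (complex_of_real v))))
      = - (LINT v|lborel. f' v * complex_of_real (Im (F (complex_of_real v))))"
    using has_weak_deriv_smooth[OF wd im(1)] Re_int(2)[OF i0] Re_int(2)[OF i1] Re_int(2)[OF i2]
    unfolding dim by simp
  ultimately show ?thesis
    using split[OF i1] split[OF i2] by simp
qed

section \<open>Bounds by the first-order norm\<close>

text \<open>
  A bound for \<open>\<bar>Ln d\<bar>\<^sup>2\<close> that depends on \<open>v\<close> alone, valid for real \<open>\<lambda> \<in> [-1, 0]\<close> and \<open>1 \<le> \<bar>\<xi>\<bar> \<le> 2\<close>. It
  uses \<open>(ln x)\<^sup>2 \<le> x\<^sup>2 + 16 / \<surd>x\<close> for \<open>x = \<bar>d\<bar>\<close>, together with \<open>\<bar>v\<bar> \<le> \<bar>d\<bar> \<le> 1 + 2 \<bar>v\<bar>\<close>; the singularity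
  at \<open>v = 0\<close> is integrable. At \<open>v = 0\<close> itself the quotient is \<open>0\<close> by convention, and the estimates
  exclude that point.
\<close>

definition log_majorant :: "real \<Rightarrow> real"
  where "log_majorant v = (1 + 2 * \<bar>v\<bar>)\<^sup>2 + 16 * (1 + indicator {- 1..1} v / sqrt \<bar>v\<bar>) + pi\<^sup>2"

text \<open>
  A common bound for \<open>\<bar>Ln d\<bar>\<close> and \<open>\<bar>2 v Ln d\<bar>\<close>.
\<close>

definition log_weight :: "real \<Rightarrow> real"
  where "log_weight v = sqrt ((1 + 4 * v\<^sup>2) * log_majorant v)"

lemma ln_power2_le:
  assumes "0 < x"
  shows "(ln x)\<^sup>2 \<le> x\<^sup>2 + 16 / sqrt x"
proof (cases "1 \<le> x")
  case True
  then have "(ln x)\<^sup>2 \<le> x\<^sup>2"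
    using ln_le_minus_one[of x] by (intro power_mono) auto
  then show ?thesis using assms by (simp add: add_increasing2)
next
  case False
  \<comment> \<open>the fourth root turns \<open>ln y \<le> y\<close> into a bound with an integrable singularity\<close>
  define y where "y = sqrt (sqrt (1 / x))"
  have y: "0 < y" "y\<^sup>2 = sqrt (1 / x)"
    using assms by (auto simp: y_def)
  have "y ^ 4 = (y\<^sup>2)\<^sup>2" by (simp flip: power_mult)
  then have y4: "y ^ 4 = 1 / x" using assms by (simp add: y(2))
  have "- ln x = ln (y ^ 4)" using assms by (simp add: y4 ln_div)
  also have "\<dots> = 4 * ln y" using y(1) by (simp add: ln_realpow)
  also have "\<dots> \<le> 4 * y" using ln_le_minus_one[of y] y(1) by simp
  finally have "- ln x \<le> 4 * y" .
  moreover have "0 \<le> - ln x" using False assms by simp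
  ultimately have "(- ln x)\<^sup>2 \<le> (4 * y)\<^sup>2" by (intro power_mono)
  also have "\<dots> = 16 / sqrt x" by (simp add: power_mult_distrib y(2) real_sqrt_divide)
  finally show ?thesis by (simp add: add_increasing)
qed

lemma cmod_Ln_power2_le:
  assumes "z \<noteq> 0"
  shows "(cmod (Ln z))\<^sup>2 \<le> (cmod z)\<^sup>2 + 16 / sqrt (cmod z) + pi\<^sup>2"
proof -
  have "(Im (Ln z))\<^sup>2 \<le> pi\<^sup>2"
    using Im_Ln_le_pi[OF assms] mpi_less_Im_Ln[OF assms]
    by (intro power2_le_iff_abs_le[THEN iffD2]) auto
  moreover have "(ln (cmod z))\<^sup>2 \<le> (cmod z)\<^sup>2 + 16 / sqrt (cmod z)"
    using assms by (intro ln_power2_le) simp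
  ultimately show ?thesis using assms by (simp add: cmod_power2)
qed

lemma log_majorant_nonneg: "0 \<le> log_majorant v"
  by (simp add: log_majorant_def)

lemma log_weight_nonneg: "0 \<le> log_weight v"
  by (simp add: log_weight_def log_majorant_nonneg)

lemma cmod_Ln_den_le:
  assumes \<xi>: "1 \<le> \<bar>\<xi>\<bar>" "\<bar>\<xi>\<bar> \<le> 2" and x: "- 1 \<le> x" "x \<le> 0" and v: "v \<noteq> 0"
  shows "cmod (Ln (den \<xi> (complex_of_real x) v)) \<le> log_weight v"
    and "cmod (2 * complex_of_real v * Ln (den \<xi> (complex_of_real x) v)) \<le> log_weight v"
proof -
  let ?d = "den \<xi> (complex_of_real x) v"
  have Im_d: "Im ?d = v * \<xi>" by (simp add: den_def)
  have "\<bar>v\<bar> * 1 \<le> \<bar>v\<bar> * \<bar>\<xi>\<bar>" using \<xi> by (intro mult_left_mono) auto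
  then have d1: "\<bar>v\<bar> \<le> cmod ?d"
    using abs_Im_le_cmod[of ?d] by (simp add: Im_d abs_mult)
  have "\<bar>v\<bar> * \<bar>\<xi>\<bar> \<le> \<bar>v\<bar> * 2" using \<xi> by (intro mult_left_mono) auto
  then have d2: "cmod ?d \<le> 1 + 2 * \<bar>v\<bar>"
    using cmod_le[of ?d] x by (simp add: Im_d abs_mult)
  have nz: "?d \<noteq> 0" using d1 v by auto
  have "(cmod (Ln ?d))\<^sup>2 \<le> (cmod ?d)\<^sup>2 + 16 / sqrt (cmod ?d) + pi\<^sup>2"
    by (rule cmod_Ln_power2_le[OF nz])
  also have "(cmod ?d)\<^sup>2 \<le> (1 + 2 * \<bar>v\<bar>)\<^sup>2" using d2 by (intro power_mono) auto
  also have "16 / sqrt (cmod ?d) \<le> 16 / sqrt \<bar>v\<bar>"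
    using d1 v by (intro divide_left_mono mult_pos_pos) auto
  also have "1 / sqrt \<bar>v\<bar> \<le> 1 + indicator {- 1..1} v / sqrt \<bar>v\<bar>"
    using v by (auto simp: indicator_def abs_le_iff)
  then have "16 / sqrt \<bar>v\<bar> \<le> 16 * (1 + indicator {- 1..1} v / sqrt \<bar>v\<bar>)" by simp
  finally have le: "(cmod (Ln ?d))\<^sup>2 \<le> log_majorant v"
    by (simp add: log_majorant_def)
  have "1 * log_majorant v \<le> (1 + 4 * v\<^sup>2) * log_majorant v"
    using log_majorant_nonneg by (intro mult_right_mono) auto
  with le show "cmod (Ln ?d) \<le> log_weight v"
    unfolding log_weight_def by (intro real_le_rsqrt) simp
  have "(cmod (2 * complex_of_real v * Ln ?d))\<^sup>2 = 4 * v\<^sup>2 * (cmod (Ln ?d))\<^sup>2"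
    by (simp add: norm_mult power_mult_distrib)
  also have "\<dots> \<le> 4 * v\<^sup>2 * log_majorant v" using le by (intro mult_left_mono) auto
  also have "\<dots> \<le> (1 + 4 * v\<^sup>2) * log_majorant v"
    using log_majorant_nonneg by (intro mult_right_mono) auto
  finally show "cmod (2 * complex_of_real v * Ln ?d) \<le> log_weight v"
    unfolding log_weight_def by (rule real_le_rsqrt)
qed

lemma inverse_sqrt_integrable: "integrable lborel (\<lambda>v::real. indicator {- 1..1} v / sqrt \<bar>v\<bar>)"
proof -
  have "set_integrable lborel (einterval 0 1) (\<lambda>x::real. 1 / sqrt x)"
  proof (rule interval_integral_FTC_nonneg[where F = "\<lambda>x. 2 * sqrt x" and A = 0 and B = 2])
    show "((\<lambda>x. 2 * sqrt x) has_real_derivative 1 / sqrt x) (at x)" if "0 < ereal x" for x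
      using that by (auto intro!: derivative_eq_intros simp: field_simps)
    have "((\<lambda>x. 2 * sqrt x) \<longlongrightarrow> 2 * sqrt 0) (at_right 0)" by (intro tendsto_intros)
    then show "(((\<lambda>x. 2 * sqrt x) \<circ> real_of_ereal) \<longlongrightarrow> 0) (at_right 0)"
      by (simp add: ereal_tendsto_simps zero_ereal_def)
    have "((\<lambda>x. 2 * sqrt x) \<longlongrightarrow> 2 * sqrt 1) (at_left 1)" by (intro tendsto_intros)
    then show "(((\<lambda>x. 2 * sqrt x) \<circ> real_of_ereal) \<longlongrightarrow> 2) (at_left 1)"
      by (simp add: ereal_tendsto_simps one_ereal_def)
  qed (auto intro!: AE_I2 continuous_intros)
  then have i: "integrable lborel (\<lambda>v::real. indicator {0<..<1} v / sqrt v)"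
    by (simp add: set_integrable_def einterval_def greaterThanLessThan_def greaterThan_def lessThan_def Int_def
        zero_ereal_def one_ereal_def)
  have "integrable lborel (\<lambda>v::real. indicator {0<..<1} v / sqrt v
      + indicator {0<..<1} (0 + (- 1) * v) / sqrt (0 + (- 1) * v))"
    using lborel_integrable_real_affine[OF i, of "- 1" 0] by (intro Bochner_Integration.integrable_add i) simp
  then show ?thesis
  proof (rule integrable_cong_AE[THEN iffD1, rotated -1])
    show "AE v in lborel. indicator {0<..<1} v / sqrt v + indicator {0<..<1} (0 + (- 1) * v) / sqrt (0 + (- 1) * v)
        = indicator {- 1..1::real} v / sqrt \<bar>v\<bar>"
      using AE_lborel_singleton[of 1] AE_lborel_singleton[of "- 1"]
      by eventually_elim (auto simp: indicator_def)
  qed measurable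
qed

lemma log_weight_L2w: "(\<lambda>v. complex_of_real (log_weight v)) \<in> L2w"
proof (rule L2wI)
  show "(\<lambda>v. complex_of_real (log_weight v)) \<in> borel_measurable borel"
    unfolding log_weight_def log_majorant_def by measurable
  have w_le: "w v \<le> 1" for v
  proof -
    have "exp (- v\<^sup>2) \<le> 1" "1 \<le> sqrt pi" using one_less_sqrt_pi by auto
    then have "exp (- v\<^sup>2) \<le> sqrt pi" "0 < sqrt pi" by linarith+
    then show ?thesis unfolding w_def by (simp only: divide_le_eq_1_pos)
  qed
  let ?i = "\<lambda>v. indicator {- 1..1} v / sqrt \<bar>v\<bar> :: real"
  have i2: "integrable lborel (\<lambda>v. 16 * ((1 + 4 * v\<^sup>2) * ?i v * w v))"
  proof (rule Bochner_Integration.integrable_bound)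
    show "integrable lborel (\<lambda>v. 80 * ?i v)" by (intro integrable_mult_right inverse_sqrt_integrable)
    show "AE v in lborel. norm (16 * ((1 + 4 * v\<^sup>2) * ?i v * w v)) \<le> norm (80 * ?i v)"
    proof (rule AE_I2)
      fix v :: real
      have "(1 + 4 * v\<^sup>2) * ?i v * w v \<le> 5 * ?i v * 1"
      proof (cases "\<bar>v\<bar> \<le> 1")
        case True
        then have "v\<^sup>2 \<le> 1" by (simp add: abs_square_le_1)
        then show ?thesis by (intro mult_mono w_le) auto
      next
        case False
        then show ?thesis by (auto simp: indicator_def)
      qed
      then show "norm (16 * ((1 + 4 * v\<^sup>2) * ?i v * w v)) \<le> norm (80 * ?i v)"
        by (simp add: abs_mult)
    qed
  qed measurable
  \<comment> \<open>with \<open>t = \<bar>v\<bar>\<close>, the regular part of the majorant is \<open>(1 + 2 t)\<^sup>2 + 16 + \<pi>\<^sup>2 = (17 + \<pi>\<^sup>2) + 4 t + 4 t\<^sup>2\<close>\<close>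
  have i1: "integrable lborel (\<lambda>v. (17 + pi\<^sup>2) * (w v * \<bar>v\<bar> ^ 0) + 4 * (w v * \<bar>v\<bar> ^ 1)
      + (4 + 4 * (17 + pi\<^sup>2)) * (w v * \<bar>v\<bar> ^ 2) + 16 * (w v * \<bar>v\<bar> ^ 3) + 16 * (w v * \<bar>v\<bar> ^ 4))"
    by (intro Bochner_Integration.integrable_add integrable_mult_right integrable_w_moment)
  have eq: "(cmod (complex_of_real (log_weight v)))\<^sup>2 * w v
    = ((17 + pi\<^sup>2) * (w v * \<bar>v\<bar> ^ 0) + 4 * (w v * \<bar>v\<bar> ^ 1)
      + (4 + 4 * (17 + pi\<^sup>2)) * (w v * \<bar>v\<bar> ^ 2) + 16 * (w v * \<bar>v\<bar> ^ 3) + 16 * (w v * \<bar>v\<bar> ^ 4))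
      + 16 * ((1 + 4 * v\<^sup>2) * ?i v * w v)" for v
  proof -
    define t where "t = \<bar>v\<bar>"
    define j where "j = ?i v"
    have "v\<^sup>2 = t\<^sup>2" by (simp add: t_def)
    moreover have "0 \<le> (1 + 4 * v\<^sup>2) * log_majorant v" by (simp add: log_majorant_nonneg)
    ultimately show ?thesis
      by (simp add: log_weight_def abs_mult log_majorant_def j_def[symmetric] t_def[symmetric])
         (simp add: algebra_simps power2_eq_square power3_eq_cube power4_eq_xxxx)
  qed
  show "integrable lborel (\<lambda>v. (cmod (complex_of_real (log_weight v)))\<^sup>2 * w v)"
    unfolding eq by (intro Bochner_Integration.integrable_add[OF i1 i2])
qed

lemma Ln_den_L2w:
  assumes "1 \<le> \<bar>\<xi>\<bar>" "\<bar>\<xi>\<bar> \<le> 2" "- 1 \<le> x" "x \<le> 0"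
  shows "(\<lambda>v. Ln (den \<xi> (complex_of_real x) v)) \<in> L2w"
    "norm_L2w (\<lambda>v. Ln (den \<xi> (complex_of_real x) v)) \<le> norm_L2w (\<lambda>v. complex_of_real (log_weight v))"
    "(\<lambda>v. 2 * complex_of_real v * Ln (den \<xi> (complex_of_real x) v)) \<in> L2w"
    "norm_L2w (\<lambda>v. 2 * complex_of_real v * Ln (den \<xi> (complex_of_real x) v))
      \<le> norm_L2w (\<lambda>v. complex_of_real (log_weight v))"
proof -
  have 1: "AE v in lborel. cmod (Ln (den \<xi> (complex_of_real x) v)) \<le> 1 * cmod (complex_of_real (log_weight v))"
    using AE_lborel_singleton[of 0]
    by eventually_elim (use cmod_Ln_den_le(1)[OF assms] log_weight_nonneg in auto)
  have 2: "AE v in lborel. cmod (2 * complex_of_real v * Ln (den \<xi> (complex_of_real x) v))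
      \<le> 1 * cmod (complex_of_real (log_weight v))"
    using AE_lborel_singleton[of 0]
    by eventually_elim (use cmod_Ln_den_le(2)[OF assms] log_weight_nonneg in auto)
  show "(\<lambda>v. Ln (den \<xi> (complex_of_real x) v)) \<in> L2w"
    "norm_L2w (\<lambda>v. Ln (den \<xi> (complex_of_real x) v)) \<le> norm_L2w (\<lambda>v. complex_of_real (log_weight v))"
    using L2w_dominated[OF log_weight_L2w _ 1] by auto
  show "(\<lambda>v. 2 * complex_of_real v * Ln (den \<xi> (complex_of_real x) v)) \<in> L2w"
    "norm_L2w (\<lambda>v. 2 * complex_of_real v * Ln (den \<xi> (complex_of_real x) v))
      \<le> norm_L2w (\<lambda>v. complex_of_real (log_weight v))"
    using L2w_dominated[OF log_weight_L2w _ 2] by auto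
qed

text \<open>
  The right-hand side \<open>\<integral> (2 v f - f') w Ln d\<close> of the integration by parts at real \<open>\<lambda> = x\<close>. Unlike the
  integral \<open>A(f)\<close> itself, it makes sense at \<open>x = -1\<close>.
\<close>

definition log_pairing :: "real \<Rightarrow> real \<Rightarrow> (real \<Rightarrow> complex) \<Rightarrow> (real \<Rightarrow> complex) \<Rightarrow> complex"
  where "log_pairing \<xi> x f f' =
    (LINT v|lborel. f v * (2 * complex_of_real v * Ln (den \<xi> (complex_of_real x) v)) * complex_of_real (w v))
    - (LINT v|lborel. f' v * Ln (den \<xi> (complex_of_real x) v) * complex_of_real (w v))"

lemma cauchy_w_by_parts:
  assumes \<xi>: "1 \<le> \<bar>\<xi>\<bar>" "\<bar>\<xi>\<bar> \<le> 2" and x: "- 1 < x" "x \<le> 0"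
    and f: "f \<in> L2w" "f' \<in> L2w" "has_weak_deriv f f'"
  shows "\<i> * complex_of_real \<xi> * cauchy_w \<xi> (complex_of_real x) f = log_pairing \<xi> x f f'"
proof -
  let ?z = "complex_of_real x"
  let ?c = "\<i> * complex_of_real \<xi>"
  have x': "- 1 \<le> x" "- 1 < Re ?z" using x by auto
  note Ln = Ln_den_L2w[OF \<xi> x'(1) x(2)]
  define S where "S = {u. 0 < Re (?c * u + 1 + ?z)}"
  define F where "F = (\<lambda>u. exp (- u\<^sup>2) / complex_of_real (sqrt pi) * Ln (?c * u + 1 + ?z))"
  have S: "open S" unfolding S_def by (intro open_Collect_less continuous_intros)
  have RS: "complex_of_real v \<in> S" for v using x by (simp add: S_def)
  have arg: "?c * complex_of_real v + 1 + ?z = den \<xi> ?z v" for v by (simp add: den_def mult_ac)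
  have w: "exp (- (complex_of_real v)\<^sup>2) / complex_of_real (sqrt pi) = complex_of_real (w v)" for v
    by (simp add: w_def exp_of_real flip: of_real_power of_real_minus)
  have F_eq: "F (complex_of_real v) = Ln (den \<xi> ?z v) * complex_of_real (w v)" for v
    unfolding F_def w arg by simp
  have DF: "(F has_field_derivative (exp (- u\<^sup>2) / complex_of_real (sqrt pi)
      * (?c / (?c * u + 1 + ?z) - 2 * u * Ln (?c * u + 1 + ?z)))) (at u)" if "u \<in> S" for u
  proof -
    have "?c * u + 1 + ?z \<notin> \<real>\<^sub>\<le>\<^sub>0" using that by (auto simp: S_def complex_nonpos_Reals_iff)
    moreover have "?c * u + 1 + ?z \<noteq> 0"
      using that unfolding S_def by (metis less_irrefl mem_Collect_eq zero_complex.sel(1))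
    ultimately have B: "((\<lambda>u. Ln (?c * u + 1 + ?z)) has_field_derivative ?c / (?c * u + 1 + ?z)) (at u)"
      by (auto intro!: derivative_eq_intros simp: divide_inverse mult.commute)
    have A: "((\<lambda>u. exp (- u\<^sup>2) / complex_of_real (sqrt pi)) has_field_derivative
        - 2 * u * (exp (- u\<^sup>2) / complex_of_real (sqrt pi))) (at u)"
      by (auto intro!: derivative_eq_intros)
    show ?thesis
      unfolding F_def by (rule DERIV_cong[OF DERIV_mult[OF A B]]) (simp add: algebra_simps)
  qed
  then have hol: "F holomorphic_on S"
    using S by (auto simp: holomorphic_on_open)
  have dF: "deriv F (complex_of_real v)
      = ?c * (complex_of_real (w v) / den \<xi> ?z v) - 2 * complex_of_real v * Ln (den \<xi> ?z v) * complex_of_real (w v)" for v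
    using DERIV_imp_deriv[OF DF[OF RS[of v]]] unfolding w arg by (simp add: algebra_simps)
  have i0: "integrable lborel (\<lambda>v. f v * F (complex_of_real v))"
    using L2w_mult_integrable[OF f(1) Ln(1)] by (simp add: F_eq mult.assoc)
  have i2: "integrable lborel (\<lambda>v. f' v * F (complex_of_real v))"
    using L2w_mult_integrable[OF f(2) Ln(1)] by (simp add: F_eq mult.assoc)
  have ia: "integrable lborel (\<lambda>v. ?c * (f v * complex_of_real (w v) / den \<xi> ?z v))"
    by (rule integrable_mult_right[OF cauchy_w_integrable[OF f(1) x'(2)]])
  note ib = L2w_mult_integrable[OF f(1) Ln(3)]
  have fdF: "f v * deriv F (complex_of_real v) = ?c * (f v * complex_of_real (w v) / den \<xi> ?z v)
      - f v * (2 * complex_of_real v * Ln (den \<xi> ?z v)) * complex_of_real (w v)" for v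
    unfolding dF by (simp add: algebra_simps)
  have i1: "integrable lborel (\<lambda>v. f v * deriv F (complex_of_real v))"
    unfolding fdF by (rule Bochner_Integration.integrable_diff[OF ia ib])
  have "(LINT v|lborel. f v * deriv F (complex_of_real v)) = - (LINT v|lborel. f' v * F (complex_of_real v))"
    by (rule has_weak_deriv_holomorphic[OF f(3) L2w_measurable[OF f(1)] L2w_measurable[OF f(2)] hol S RS i0 i1 i2])
  moreover have "(LINT v|lborel. f v * deriv F (complex_of_real v))
      = ?c * cauchy_w \<xi> ?z f - (LINT v|lborel. f v * (2 * complex_of_real v * Ln (den \<xi> ?z v)) * complex_of_real (w v))"
    unfolding fdF Bochner_Integration.integral_diff[OF ia ib] integral_mult_right_zero cauchy_w_def ..
  moreover have "(LINT v|lborel. f' v * F (complex_of_real v))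
      = (LINT v|lborel. f' v * Ln (den \<xi> ?z v) * complex_of_real (w v))"
    by (simp add: F_eq mult.assoc)
  ultimately show ?thesis
    unfolding log_pairing_def by (simp add: algebra_simps)
qed

lemma log_pairing_bound:
  assumes \<xi>: "1 \<le> \<bar>\<xi>\<bar>" "\<bar>\<xi>\<bar> \<le> 2" and x: "- 1 \<le> x" "x \<le> 0"
    and f: "f \<in> L2w" "f' \<in> L2w"
  shows "cmod (log_pairing \<xi> x f f')
    \<le> 2 * norm_L2w (\<lambda>v. complex_of_real (log_weight v)) * sqrt ((norm_L2w f)\<^sup>2 + (norm_L2w f')\<^sup>2)"
proof -
  let ?N = "norm_L2w (\<lambda>v. complex_of_real (log_weight v))"
  let ?s = "sqrt ((norm_L2w f)\<^sup>2 + (norm_L2w f')\<^sup>2)"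
  note Ln = Ln_den_L2w[OF \<xi> x]
  have "cmod (log_pairing \<xi> x f f') \<le> norm_L2w f * ?N + norm_L2w f' * ?N"
    unfolding log_pairing_def
    by (intro order_trans[OF norm_triangle_ineq4] add_mono
        order_trans[OF L2w_Cauchy_Schwarz[OF f(1) Ln(3)]] order_trans[OF L2w_Cauchy_Schwarz[OF f(2) Ln(1)]]
        mult_left_mono Ln norm_L2w_nonneg)
  also have "\<dots> \<le> ?s * ?N + ?s * ?N"
    by (intro add_mono mult_right_mono norm_L2w_nonneg real_le_rsqrt) auto
  finally show ?thesis by (simp add: mult_ac)
qed

lemma log_pairing_tendsto:
  assumes \<xi>: "1 \<le> \<bar>\<xi>\<bar>" "\<bar>\<xi>\<bar> \<le> 2" and f: "f \<in> L2w" "f' \<in> L2w"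
  shows "((\<lambda>s. log_pairing \<xi> (s - 1) f f') \<longlongrightarrow> log_pairing \<xi> (- 1) f f') (at_right 0)"
proof -
  note [measurable] = L2w_measurable[OF f(1)] L2w_measurable[OF f(2)]
  have main: "(\<lambda>n. log_pairing \<xi> (X n - 1) f f') \<longlonglongrightarrow> log_pairing \<xi> (- 1) f f'"
    if X: "\<And>n. 0 < X n" "\<And>n. X n \<le> 1" "X \<longlonglongrightarrow> 0" for X
  proof -
    have Xb: "- 1 \<le> X n - 1" "X n - 1 \<le> 0" for n using X(1,2)[of n] by auto
    have Ln_lim: "(\<lambda>n. Ln (den \<xi> (complex_of_real (X n - 1)) v)) \<longlonglongrightarrow> Ln (den \<xi> (complex_of_real (- 1)) v)"
      if v: "v \<noteq> 0" for v
    proof (rule tendsto_Ln)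
      have "(\<lambda>n. X n - 1) \<longlonglongrightarrow> - 1"
        using tendsto_diff[OF X(3) tendsto_const[of 1]] by simp
      then show "(\<lambda>n. den \<xi> (complex_of_real (X n - 1)) v) \<longlonglongrightarrow> den \<xi> (complex_of_real (- 1)) v"
        unfolding den_def by (intro tendsto_add tendsto_const tendsto_of_real)
      show "den \<xi> (complex_of_real (- 1)) v \<notin> \<real>\<^sub>\<le>\<^sub>0"
        using v \<xi> by (auto simp: den_def complex_nonpos_Reals_iff)
    qed
    have dom: "integrable lborel (\<lambda>v. cmod (g v) * log_weight v * w v)" if "g \<in> L2w" for g
      using integrable_norm[OF L2w_mult_integrable[OF that log_weight_L2w]] log_weight_nonneg by (simp add: norm_mult)
    show ?thesis
      unfolding log_pairing_def
    proof (rule tendsto_diff)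
      show "(\<lambda>n. LINT v|lborel. f v * (2 * complex_of_real v * Ln (den \<xi> (complex_of_real (X n - 1)) v)) * complex_of_real (w v))
        \<longlonglongrightarrow> (LINT v|lborel. f v * (2 * complex_of_real v * Ln (den \<xi> (complex_of_real (- 1)) v)) * complex_of_real (w v))"
      proof (rule integral_dominated_convergence[OF _ _ dom[OF f(1)]])
        show "AE v in lborel. (\<lambda>n. f v * (2 * complex_of_real v * Ln (den \<xi> (complex_of_real (X n - 1)) v)) * complex_of_real (w v))
          \<longlonglongrightarrow> f v * (2 * complex_of_real v * Ln (den \<xi> (complex_of_real (- 1)) v)) * complex_of_real (w v)"
          using AE_lborel_singleton[of 0] by eventually_elim (intro tendsto_intros Ln_lim)
        show "AE v in lborel. norm (f v * (2 * complex_of_real v * Ln (den \<xi> (complex_of_real (X n - 1)) v)) * complex_of_real (w v))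
          \<le> cmod (f v) * log_weight v * w v" for n
          using AE_lborel_singleton[of 0]
        proof eventually_elim
          case (elim v)
          then show ?case
            unfolding norm_mult[of _ "complex_of_real (w v)"] norm_mult[of "f v"] norm_of_real abs_of_nonneg[OF w_nonneg]
            by (intro mult_right_mono mult_left_mono cmod_Ln_den_le \<xi> Xb) auto
        qed
      qed measurable
      show "(\<lambda>n. LINT v|lborel. f' v * Ln (den \<xi> (complex_of_real (X n - 1)) v) * complex_of_real (w v))
        \<longlonglongrightarrow> (LINT v|lborel. f' v * Ln (den \<xi> (complex_of_real (- 1)) v) * complex_of_real (w v))"
      proof (rule integral_dominated_convergence[OF _ _ dom[OF f(2)]])
        show "AE v in lborel. (\<lambda>n. f' v * Ln (den \<xi> (complex_of_real (X n - 1)) v) * complex_of_real (w v))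
          \<longlonglongrightarrow> f' v * Ln (den \<xi> (complex_of_real (- 1)) v) * complex_of_real (w v)"
          using AE_lborel_singleton[of 0] by eventually_elim (intro tendsto_intros Ln_lim)
        show "AE v in lborel. norm (f' v * Ln (den \<xi> (complex_of_real (X n - 1)) v) * complex_of_real (w v))
          \<le> cmod (f' v) * log_weight v * w v" for n
          using AE_lborel_singleton[of 0]
        proof eventually_elim
          case (elim v)
          then show ?case
            unfolding norm_mult[of _ "complex_of_real (w v)"] norm_mult[of "f' v"] norm_of_real abs_of_nonneg[OF w_nonneg]
            by (intro mult_right_mono mult_left_mono cmod_Ln_den_le \<xi> Xb) auto
        qed
      qed measurable
    qed
  qed
  have "((\<lambda>s. log_pairing \<xi> (s - 1) f f') \<longlongrightarrow> log_pairing \<xi> (- 1) f f') (at 0 within {0..1})"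
    unfolding tendsto_at_iff_sequentially comp_def
  proof (intro allI impI)
    fix X :: "nat \<Rightarrow> real" assume "\<forall>i. X i \<in> {0..1} - {0}" "X \<longlonglongrightarrow> 0"
    then show "(\<lambda>n. log_pairing \<xi> (X n - 1) f f') \<longlonglongrightarrow> log_pairing \<xi> (- 1) f f'"
      by (intro main) (auto simp: less_le)
  qed
  then show ?thesis by (simp add: at_within_Icc_at_right)
qed

text \<open>
  The norm is computed with a chosen weak derivative; that one is produced here. The estimates are
  stated for an arbitrary weak derivative, so that they apply to conjugates without a proof that
  weak derivatives are unique.
\<close>

lemma H1w_weak_deriv:
  assumes "f \<in> H1w"
  obtains f' where "f \<in> L2w" "f' \<in> L2w" "has_weak_deriv f f'"
    "norm_H1w f = sqrt ((norm_L2w f)\<^sup>2 + (norm_L2w f')\<^sup>2)"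
proof -
  let ?f' = "SOME f'. f' \<in> L2w \<and> has_weak_deriv f f'"
  have "?f' \<in> L2w \<and> has_weak_deriv f ?f'"
    using assms someI_ex[of "\<lambda>f'. f' \<in> L2w \<and> has_weak_deriv f f'"] by (auto simp: H1w_def)
  moreover have "f \<in> L2w" using assms by (simp add: H1w_def)
  ultimately show thesis by (intro that[of ?f']) (simp_all add: norm_H1w_def)
qed

lemma norm_H1w_nonneg: "0 \<le> norm_H1w f"
  by (simp add: norm_H1w_def)

lemma has_weak_deriv_cnj:
  assumes "has_weak_deriv f f'"
  shows "has_weak_deriv (\<lambda>v. cnj (f v)) (\<lambda>v. cnj (f' v))"
  unfolding has_weak_deriv_def
proof (intro allI impI)
  fix \<phi> assume "test_function \<phi>"
  then have eq: "(LINT v|lborel. f v * complex_of_real (deriv \<phi> v)) = - (LINT v|lborel. f' v * complex_of_real (\<phi> v))"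
    using assms by (simp add: has_weak_deriv_def)
  have cnj_int: "(LINT v|lborel. cnj (g v) * complex_of_real (r v)) = cnj (LINT v|lborel. g v * complex_of_real (r v))"
    for g :: "real \<Rightarrow> complex" and r
    using Bochner_Integration.integral_cnj[of lborel "\<lambda>v. g v * complex_of_real (r v)"] by simp
  show "(LINT v|lborel. cnj (f v) * complex_of_real (deriv \<phi> v)) = - (LINT v|lborel. cnj (f' v) * complex_of_real (\<phi> v))"
    unfolding cnj_int eq by simp
qed

lemma H1w_cnj:
  assumes "f \<in> H1w"
  shows "(\<lambda>v. cnj (f v)) \<in> H1w"
proof -
  obtain f' where "f \<in> L2w" "f' \<in> L2w" "has_weak_deriv f f'"
    using assms by (rule H1w_weak_deriv)
  then show ?thesis
    using L2w_cnj has_weak_deriv_cnj unfolding H1w_def by blast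
qed

text \<open>
  The constant in \<open>\<bar>A(f)\<bar> \<le> C \<parallel>f\<parallel>\<close> with the first-order norm, at \<open>\<lambda> = \<lambda>*\<close> and in the edge limits: the first term of the maximum is for
  \<open>\<bar>\<xi>\<bar> \<ge> 1\<close>, the second, from the lower bound on \<open>1 + \<lambda>*\<close>, for \<open>\<bar>\<xi>\<bar> \<le> 1\<close>.
\<close>

definition cauchy_const :: real
  where "cauchy_const = max (2 * norm_L2w (\<lambda>v. complex_of_real (log_weight v))) (2 / (sqrt pi - 1))"

lemma cauchy_const_nonneg: "0 \<le> cauchy_const"
  by (simp add: cauchy_const_def le_max_iff_disj)

lemma cauchy_w_lambda_star_bound:
  assumes \<xi>: "\<bar>\<xi>\<bar> < sqrt pi" and f: "f \<in> L2w" "f' \<in> L2w" "has_weak_deriv f f'"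
  shows "cmod (cauchy_w \<xi> (complex_of_real (lambda_star \<xi>)) f)
    \<le> cauchy_const * sqrt ((norm_L2w f)\<^sup>2 + (norm_L2w f')\<^sup>2)"
proof (cases "\<bar>\<xi>\<bar> \<le> 1")
  case True
  let ?l = "lambda_star \<xi>"
  note l = lambda_star[OF \<xi>]
  have "cmod (cauchy_w \<xi> (complex_of_real ?l) f) \<le> norm_L2w f / (1 + ?l)"
    using cmod_cauchy_w_le[OF f(1), of "complex_of_real ?l" \<xi>] l(1) by simp
  also have "\<dots> \<le> norm_L2w f / ((sqrt pi - 1) / 2)"
    using lambda_star_ge[OF True] one_less_sqrt_pi by (intro divide_left_mono mult_pos_pos) (auto, use l(1) in linarith)
  also have "\<dots> = (2 / (sqrt pi - 1)) * norm_L2w f" by simp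
  also have "\<dots> \<le> cauchy_const * sqrt ((norm_L2w f)\<^sup>2 + (norm_L2w f')\<^sup>2)"
    using cauchy_const_nonneg
    by (intro mult_mono real_le_rsqrt) (auto simp: cauchy_const_def)
  finally show ?thesis .
next
  case False
  let ?l = "lambda_star \<xi>"
  note l = lambda_star[OF \<xi>]
  have \<xi>': "1 \<le> \<bar>\<xi>\<bar>" "\<bar>\<xi>\<bar> \<le> 2" using False \<xi> sqrt_pi_less_two by auto
  have "1 * cmod (cauchy_w \<xi> (complex_of_real ?l) f) \<le> \<bar>\<xi>\<bar> * cmod (cauchy_w \<xi> (complex_of_real ?l) f)"
    using \<xi>' by (intro mult_right_mono) auto
  also have "\<dots> = cmod (log_pairing \<xi> ?l f f')"
    using cauchy_w_by_parts[OF \<xi>' l(1,2) f, symmetric] by (simp add: norm_mult)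
  also have "\<dots> \<le> 2 * norm_L2w (\<lambda>v. complex_of_real (log_weight v)) * sqrt ((norm_L2w f)\<^sup>2 + (norm_L2w f')\<^sup>2)"
    using l by (intro log_pairing_bound \<xi>' f) auto
  also have "\<dots> \<le> cauchy_const * sqrt ((norm_L2w f)\<^sup>2 + (norm_L2w f')\<^sup>2)"
    by (intro mult_right_mono) (auto simp: cauchy_const_def)
  finally show ?thesis by simp
qed

subsection \<open>The limits at the edge\<close>

text \<open>
  With \<open>s = \<xi> b\<close>, the one-sided limit \<open>b \<rightarrow> 0\<close> from the side given by the sign of \<open>\<xi>\<close> becomes the limit
  \<open>s \<rightarrow> 0\<close> from the right, for either sign.
\<close>

lemma edge_limit_eqI:
  assumes \<xi>: "\<xi> \<noteq> 0"
    and lim: "((\<lambda>s. cauchy_w \<xi> (complex_of_real (s - 1)) f) \<longlongrightarrow> l) (at_right 0)"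
  shows "edge_limit \<xi> f = l"
proof -
  define F :: "real filter" where "F = (if 0 < \<xi> then at_right 0 else at_left 0)"
  have "F \<noteq> bot" by (simp add: F_def)
  have pos: "\<forall>\<^sub>F b in F. 0 < \<xi> * b"
    using \<xi> by (auto simp: F_def eventually_at_filter zero_less_mult_iff intro!: always_eventually)
  have "((\<lambda>b. \<xi> * b) \<longlongrightarrow> \<xi> * 0) (at 0)" by (intro tendsto_intros)
  then have "((\<lambda>b. \<xi> * b) \<longlongrightarrow> 0) F"
    unfolding F_def by (auto intro: tendsto_mono[OF at_le])
  then have "filterlim (\<lambda>b. \<xi> * b) (at_right 0) F"
    using pos by (auto simp: filterlim_at elim!: eventually_mono)
  from filterlim_compose[OF lim this]
  have "((\<lambda>b. cauchy_w \<xi> (complex_of_real (\<xi> * b - 1)) f) \<longlongrightarrow> l) F" .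
  moreover have "cauchy_w \<xi> (complex_of_real (\<xi> * b - 1)) f = (LINT v|lborel. f v * complex_of_real (w v) /
         (\<i> * complex_of_real \<xi> * (complex_of_real v - \<i> * complex_of_real b)))" for b
  proof -
    have "den \<xi> (complex_of_real (\<xi> * b - 1)) v = \<i> * complex_of_real \<xi> * (complex_of_real v - \<i> * complex_of_real b)" for v
      by (simp add: den_def algebra_simps)
    then show ?thesis by (simp add: cauchy_w_def)
  qed
  ultimately have "Lim F (\<lambda>b. LINT v|lborel. f v * complex_of_real (w v) /
         (\<i> * complex_of_real \<xi> * (complex_of_real v - \<i> * complex_of_real b))) = l"
    using \<open>F \<noteq> bot\<close> by (intro tendsto_Lim) auto
  then show ?thesis by (simp add: edge_limit_def F_def)
qed

lemma edge_limit_log_pairing: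
  assumes \<xi>: "1 \<le> \<bar>\<xi>\<bar>" "\<bar>\<xi>\<bar> \<le> 2" and f: "f \<in> L2w" "f' \<in> L2w" "has_weak_deriv f f'"
  shows "((\<lambda>s. cauchy_w \<xi> (complex_of_real (s - 1)) f) \<longlongrightarrow> edge_limit \<xi> f) (at_right 0)"
    and "cmod (edge_limit \<xi> f) \<le> cauchy_const * sqrt ((norm_L2w f)\<^sup>2 + (norm_L2w f')\<^sup>2)"
proof -
  let ?c = "\<i> * complex_of_real \<xi>"
  have c: "?c \<noteq> 0" using \<xi> by auto
  have "((\<lambda>s. log_pairing \<xi> (s - 1) f f' / ?c) \<longlongrightarrow> log_pairing \<xi> (- 1) f f' / ?c) (at_right 0)"
    by (intro tendsto_divide log_pairing_tendsto \<xi> f tendsto_const c)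
  moreover have "\<forall>\<^sub>F s in at_right 0. log_pairing \<xi> (s - 1) f f' / ?c = cauchy_w \<xi> (complex_of_real (s - 1)) f"
    using eventually_at_right_real[of 0 1]
  proof (rule eventually_mono)
    fix s :: real assume "s \<in> {0<..<1}"
    then show "log_pairing \<xi> (s - 1) f f' / ?c = cauchy_w \<xi> (complex_of_real (s - 1)) f"
      using cauchy_w_by_parts[OF \<xi> _ _ f, of "s - 1"] c by (auto simp: field_simps)
  qed simp
  ultimately have lim: "((\<lambda>s. cauchy_w \<xi> (complex_of_real (s - 1)) f) \<longlongrightarrow> log_pairing \<xi> (- 1) f f' / ?c) (at_right 0)"
    by (rule Lim_transform_eventually)
  have eq: "edge_limit \<xi> f = log_pairing \<xi> (- 1) f f' / ?c"
    by (rule edge_limit_eqI[OF _ lim]) (use \<xi> in auto)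
  with lim show "((\<lambda>s. cauchy_w \<xi> (complex_of_real (s - 1)) f) \<longlongrightarrow> edge_limit \<xi> f) (at_right 0)" by simp
  have "cmod (edge_limit \<xi> f) = cmod (log_pairing \<xi> (- 1) f f') / \<bar>\<xi>\<bar>"
    by (simp add: eq norm_divide norm_mult)
  also have "\<dots> \<le> cmod (log_pairing \<xi> (- 1) f f') / 1"
    using \<xi> by (intro divide_left_mono) auto
  also have "\<dots> \<le> 2 * norm_L2w (\<lambda>v. complex_of_real (log_weight v)) * sqrt ((norm_L2w f)\<^sup>2 + (norm_L2w f')\<^sup>2)"
    using log_pairing_bound[OF \<xi> _ _ f(1,2), of "- 1"] by simp
  also have "\<dots> \<le> cauchy_const * sqrt ((norm_L2w f)\<^sup>2 + (norm_L2w f')\<^sup>2)"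
    by (intro mult_right_mono) (auto simp: cauchy_const_def)
  finally show "cmod (edge_limit \<xi> f) \<le> cauchy_const * sqrt ((norm_L2w f)\<^sup>2 + (norm_L2w f')\<^sup>2)" .
qed

lemma edge_limit_linear:
  assumes \<xi>: "1 \<le> \<bar>\<xi>\<bar>" "\<bar>\<xi>\<bar> \<le> 2" and f: "f \<in> H1w" and g: "g \<in> H1w"
  shows "edge_limit \<xi> (\<lambda>v. a * f v + b * g v) = a * edge_limit \<xi> f + b * edge_limit \<xi> g"
proof (rule edge_limit_eqI)
  have lim: "((\<lambda>s. cauchy_w \<xi> (complex_of_real (s - 1)) h) \<longlongrightarrow> edge_limit \<xi> h) (at_right 0)" if "h \<in> H1w" for h
    using that by (rule H1w_weak_deriv) (rule edge_limit_log_pairing[OF \<xi>])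
  have "((\<lambda>s. a * cauchy_w \<xi> (complex_of_real (s - 1)) f + b * cauchy_w \<xi> (complex_of_real (s - 1)) g)
      \<longlongrightarrow> a * edge_limit \<xi> f + b * edge_limit \<xi> g) (at_right 0)"
    by (intro tendsto_intros lim f g)
  moreover have "\<forall>\<^sub>F s in at_right 0. a * cauchy_w \<xi> (complex_of_real (s - 1)) f + b * cauchy_w \<xi> (complex_of_real (s - 1)) g
      = cauchy_w \<xi> (complex_of_real (s - 1)) (\<lambda>v. a * f v + b * g v)"
    using eventually_at_right_less[of 0]
    by eventually_elim (use f g in \<open>simp add: cauchy_w_linear H1w_def\<close>)
  ultimately show "((\<lambda>s. cauchy_w \<xi> (complex_of_real (s - 1)) (\<lambda>v. a * f v + b * g v))
      \<longlongrightarrow> a * edge_limit \<xi> f + b * edge_limit \<xi> g) (at_right 0)"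
    by (rule Lim_transform_eventually)
qed (use \<xi> in auto)

lemma edge_limit_bound:
  assumes \<xi>: "1 \<le> \<bar>\<xi>\<bar>" "\<bar>\<xi>\<bar> \<le> 2" and f: "f \<in> H1w"
  shows "cmod (edge_limit \<xi> f) \<le> cauchy_const * norm_H1w f"
    and "cmod (edge_limit \<xi> (\<lambda>v. cnj (f v))) \<le> cauchy_const * norm_H1w f"
proof -
  obtain f' where f': "f \<in> L2w" "f' \<in> L2w" "has_weak_deriv f f'"
    "norm_H1w f = sqrt ((norm_L2w f)\<^sup>2 + (norm_L2w f')\<^sup>2)"
    using f by (rule H1w_weak_deriv)
  show "cmod (edge_limit \<xi> f) \<le> cauchy_const * norm_H1w f"
    unfolding f'(4) by (rule edge_limit_log_pairing(2)[OF \<xi> f'(1-3)])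
  show "cmod (edge_limit \<xi> (\<lambda>v. cnj (f v))) \<le> cauchy_const * norm_H1w f"
    using edge_limit_log_pairing(2)[OF \<xi> L2w_cnj[OF f'(1)] L2w_cnj[OF f'(2)] has_weak_deriv_cnj[OF f'(3)]]
    unfolding f'(4) norm_L2w_cnj .
qed

lemma edge_functional_Hm1w:
  assumes \<xi>: "1 \<le> \<bar>\<xi>\<bar>" "\<bar>\<xi>\<bar> \<le> 2"
  shows "(\<lambda>h. c * edge_limit \<xi> (\<lambda>v. cnj (h v))) \<in> Hm1w"
  unfolding Hm1w_def
proof (intro CollectI conjI ballI allI exI)
  fix g h a b assume gh: "g \<in> H1w" "h \<in> H1w"
  from edge_limit_linear[OF \<xi> H1w_cnj[OF gh(1)] H1w_cnj[OF gh(2)], of "cnj a" "cnj b"]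
  show "c * edge_limit \<xi> (\<lambda>v. cnj (a * g v + b * h v))
    = cnj a * (c * edge_limit \<xi> (\<lambda>v. cnj (g v))) + cnj b * (c * edge_limit \<xi> (\<lambda>v. cnj (h v)))"
    by (simp add: algebra_simps)
next
  fix g assume "g \<in> H1w"
  from mult_left_mono[OF edge_limit_bound(2)[OF \<xi> this] norm_ge_zero[of c]]
  show "cmod (c * edge_limit \<xi> (\<lambda>v. cnj (g v))) \<le> (cmod c * cauchy_const) * norm_H1w g"
    by (simp add: norm_mult mult.assoc)
qed

section \<open>Finite rank and uniform bounds\<close>

lemma finite_rank_P_lambda:
  assumes \<xi>: "\<bar>\<xi>\<bar> < sqrt pi"
  shows "finite_rank_L2w (P_lambda \<xi>)"
proof -
  define \<mu> where "\<mu> = complex_of_real (lambda_star \<xi>)"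
  have Re_\<mu>: "- 1 < Re \<mu>" using lambda_star(1)[OF \<xi>] by (simp add: \<mu>_def)
  obtain D where P: "\<And>f. f \<in> L2w \<Longrightarrow> P_lambda \<xi> f \<in> L2w"
    and P_eq: "\<And>f. f \<in> L2w \<Longrightarrow> AE v in lborel. P_lambda \<xi> f v = cauchy_w \<xi> \<mu> f / D * (1 / den \<xi> \<mu> v)"
    using P_lambda_rank_one[OF \<xi> \<mu>_def] by metis
  show ?thesis
    unfolding finite_rank_L2w_def
  proof (intro conjI ballI allI)
    fix f g a b assume fg: "f \<in> L2w" "g \<in> L2w"
    then have "(\<lambda>x. a * f x + b * g x) \<in> L2w" by (intro L2w_add L2w_scale)
    from P_eq[OF this] P_eq[OF fg(1)] P_eq[OF fg(2)]
    show "AE v in lborel. P_lambda \<xi> (\<lambda>x. a * f x + b * g x) v = a * P_lambda \<xi> f v + b * P_lambda \<xi> g v"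
      by eventually_elim (simp add: cauchy_w_linear[OF fg Re_\<mu>] add_divide_distrib algebra_simps)
  next
    show "\<exists>U. finite U \<and> U \<subseteq> L2w \<and> (\<forall>f\<in>L2w. \<exists>c. AE v in lborel. P_lambda \<xi> f v = (\<Sum>u\<in>U. c u * u v))"
    proof (intro exI conjI ballI)
      show "{\<lambda>v. 1 / den \<xi> \<mu> v} \<subseteq> L2w" using inverse_den_L2w(1)[OF Re_\<mu>] by simp
      fix f assume "f \<in> L2w"
      from P_eq[OF this]
      show "AE v in lborel. P_lambda \<xi> f v = (\<Sum>u\<in>{\<lambda>v. 1 / den \<xi> \<mu> v}. (\<lambda>_. cauchy_w \<xi> \<mu> f / D) u * u v)"
        by simp
    qed simp
  qed (use P in auto)
qed

text \<open>
  Neither this nor the bound on the edge form involves the value of \<^const>\<open>omega_plus_deriv\<close>, which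
  only enters as a scalar factor.
\<close>

lemma finite_rank_P_edge:
  assumes \<xi>: "1 \<le> \<bar>\<xi>\<bar>" "\<bar>\<xi>\<bar> \<le> 2"
  shows "finite_rank_Hm1w (P_edge \<xi>)"
proof -
  let ?k = "1 / omega_plus_deriv \<xi>"
  let ?E = "\<lambda>h. 1 * edge_limit \<xi> (\<lambda>v. cnj (h v))"
  show ?thesis
    unfolding finite_rank_Hm1w_def
  proof (intro conjI ballI allI)
    fix f assume "f \<in> H1w"
    show "P_edge \<xi> f \<in> Hm1w"
      unfolding P_edge_def[abs_def] by (rule edge_functional_Hm1w[OF \<xi>])
  next
    fix f g a b h assume "f \<in> H1w" "g \<in> H1w"
    then show "P_edge \<xi> (\<lambda>x. a * f x + b * g x) h = a * P_edge \<xi> f h + b * P_edge \<xi> g h"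
      by (simp add: P_edge_def edge_limit_linear[OF \<xi>] add_divide_distrib algebra_simps)
  next
    show "\<exists>U. finite U \<and> U \<subseteq> Hm1w \<and> (\<forall>f\<in>H1w. \<exists>c. \<forall>h\<in>H1w. P_edge \<xi> f h = (\<Sum>u\<in>U. c u * u h))"
    proof (intro exI conjI ballI)
      show "{?E} \<subseteq> Hm1w" using edge_functional_Hm1w[OF \<xi>, of 1] by simp
      show "P_edge \<xi> f h = (\<Sum>u\<in>{?E}. (\<lambda>_. ?k * edge_limit \<xi> f) u * u h)" for f h
        by (simp add: P_edge_def)
    qed simp
  qed
qed

lemma inverse_cmod_le:
  assumes "exp (- 4) / 2 \<le> cmod D"
  shows "1 / cmod D \<le> 2 * exp 4"
proof -
  have "exp 4 * (exp (- 4) / 2) \<le> exp 4 * cmod D" using assms by (intro mult_left_mono) auto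
  moreover have "exp 4 * exp (- 4) = (1 :: real)" by (simp flip: exp_add)
  moreover have "0 < cmod D" using assms by (intro less_le_trans[OF _ assms]) simp
  ultimately show ?thesis by (simp add: pos_divide_le_eq)
qed

lemma P_lambda_outside: "\<not> \<bar>\<xi>\<bar> < sqrt pi \<Longrightarrow> inner_w (P_lambda \<xi> f) g = 0"
  by (simp add: P_lambda_def inner_w_def)

lemma P_lambda_L2w_bound:
  assumes f: "f \<in> L2w" and g: "g \<in> L2w"
  shows "cmod (inner_w (P_lambda \<xi> f) g) \<le> 2 * exp 4 / (1 + lambda_star \<xi>)\<^sup>2 * norm_L2w f * norm_L2w g"
proof (cases "\<bar>\<xi>\<bar> < sqrt pi")
  case True
  define \<mu> where "\<mu> = complex_of_real (lambda_star \<xi>)"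
  have Re_\<mu>: "- 1 < Re \<mu>" using lambda_star(1)[OF True] by (simp add: \<mu>_def)
  obtain D where D: "exp (- 4) / 2 \<le> cmod D"
    and P: "inner_w (P_lambda \<xi> f) g = cauchy_w \<xi> \<mu> f * cauchy_w \<xi> \<mu> (\<lambda>v. cnj (g v)) / D"
    using P_lambda_rank_one[OF True \<mu>_def] f g by metis
  have "cmod (inner_w (P_lambda \<xi> f) g) = (1 / cmod D) * (cmod (cauchy_w \<xi> \<mu> f) * cmod (cauchy_w \<xi> \<mu> (\<lambda>v. cnj (g v))))"
    unfolding P norm_divide norm_mult by simp
  also have "\<dots> \<le> (2 * exp 4) * ((norm_L2w f / (1 + Re \<mu>)) * (norm_L2w (\<lambda>v. cnj (g v)) / (1 + Re \<mu>)))"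
    using Re_\<mu> by (intro mult_mono inverse_cmod_le[OF D] cmod_cauchy_w_le f L2w_cnj g) auto
  finally show ?thesis
    by (simp add: norm_L2w_cnj \<mu>_def power2_eq_square)
next
  case False
  then show ?thesis by (simp add: P_lambda_outside)
qed

lemma P_lambda_H1w_bound:
  assumes f: "f \<in> H1w" and g: "g \<in> H1w"
  shows "cmod (inner_w (P_lambda \<xi> f) g) \<le> 2 * exp 4 * cauchy_const\<^sup>2 * norm_H1w f * norm_H1w g"
proof (cases "\<bar>\<xi>\<bar> < sqrt pi")
  case True
  define \<mu> where "\<mu> = complex_of_real (lambda_star \<xi>)"
  obtain f' where f': "f \<in> L2w" "f' \<in> L2w" "has_weak_deriv f f'"
    "norm_H1w f = sqrt ((norm_L2w f)\<^sup>2 + (norm_L2w f')\<^sup>2)"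
    using f by (rule H1w_weak_deriv)
  obtain g' where g': "g \<in> L2w" "g' \<in> L2w" "has_weak_deriv g g'"
    "norm_H1w g = sqrt ((norm_L2w g)\<^sup>2 + (norm_L2w g')\<^sup>2)"
    using g by (rule H1w_weak_deriv)
  obtain D where D: "exp (- 4) / 2 \<le> cmod D"
    and P: "inner_w (P_lambda \<xi> f) g = cauchy_w \<xi> \<mu> f * cauchy_w \<xi> \<mu> (\<lambda>v. cnj (g v)) / D"
    using P_lambda_rank_one[OF True \<mu>_def] f'(1) g'(1) by metis
  have A: "cmod (cauchy_w \<xi> \<mu> f) \<le> cauchy_const * norm_H1w f"
    unfolding f'(4) \<mu>_def by (rule cauchy_w_lambda_star_bound[OF True f'(1-3)])
  have B: "cmod (cauchy_w \<xi> \<mu> (\<lambda>v. cnj (g v))) \<le> cauchy_const * norm_H1w g"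
    using cauchy_w_lambda_star_bound[OF True L2w_cnj[OF g'(1)] L2w_cnj[OF g'(2)] has_weak_deriv_cnj[OF g'(3)]]
    unfolding g'(4) \<mu>_def norm_L2w_cnj .
  have "cmod (inner_w (P_lambda \<xi> f) g) = (1 / cmod D) * (cmod (cauchy_w \<xi> \<mu> f) * cmod (cauchy_w \<xi> \<mu> (\<lambda>v. cnj (g v))))"
    unfolding P norm_divide norm_mult by simp
  also have "\<dots> \<le> (2 * exp 4) * ((cauchy_const * norm_H1w f) * (cauchy_const * norm_H1w g))"
    using cauchy_const_nonneg norm_H1w_nonneg
    by (intro mult_mono inverse_cmod_le[OF D] A B) auto
  finally show ?thesis by (simp add: power2_eq_square mult_ac)
next
  case False
  then show ?thesis by (simp add: P_lambda_outside norm_H1w_nonneg)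
qed

lemma P_edge_H1w_bound:
  assumes \<xi>: "1 \<le> \<bar>\<xi>\<bar>" "\<bar>\<xi>\<bar> \<le> 2" and f: "f \<in> H1w" and g: "g \<in> H1w"
  shows "cmod (P_edge \<xi> f g) \<le> cmod (1 / omega_plus_deriv \<xi>) * cauchy_const\<^sup>2 * norm_H1w f * norm_H1w g"
proof -
  have "cmod (P_edge \<xi> f g) = cmod (1 / omega_plus_deriv \<xi>) * (cmod (edge_limit \<xi> f) * cmod (edge_limit \<xi> (\<lambda>v. cnj (g v))))"
    by (simp add: P_edge_def norm_mult norm_divide)
  also have "\<dots> \<le> cmod (1 / omega_plus_deriv \<xi>) * ((cauchy_const * norm_H1w f) * (cauchy_const * norm_H1w g))"
    using cauchy_const_nonneg norm_H1w_nonneg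
    by (intro mult_left_mono mult_mono edge_limit_bound \<xi> f g) auto
  finally show ?thesis by (simp add: power2_eq_square mult_ac)
qed

theorem corollary7p8:
  shows "(\<forall>\<xi>\<in>{- sqrt pi<..<sqrt pi}. finite_rank_L2w (P_lambda \<xi>)) \<and>
    finite_rank_Hm1w (P_edge (sqrt pi)) \<and>
    finite_rank_Hm1w (P_edge (- sqrt pi)) \<and>
    (\<exists>C :: real \<Rightarrow> real. \<forall>\<xi>. \<xi> \<noteq> sqrt pi \<and> \<xi> \<noteq> - sqrt pi \<longrightarrow>
      (\<forall>f\<in>L2w. \<forall>g\<in>L2w.
        cmod (inner_w (P_lambda \<xi> f) g) \<le> C \<xi> * norm_L2w f * norm_L2w g)) \<and>
    (\<exists>C :: real. \<forall>\<xi>. \<forall>f\<in>H1w. \<forall>g\<in>H1w.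
      cmod (P_pairing \<xi> f g) \<le> C * norm_H1w f * norm_H1w g)"
proof (intro conjI)
  have sp: "1 \<le> \<bar>sqrt pi\<bar>" "\<bar>sqrt pi\<bar> \<le> 2" "1 \<le> \<bar>- sqrt pi\<bar>" "\<bar>- sqrt pi\<bar> \<le> 2"
    using one_less_sqrt_pi sqrt_pi_less_two by linarith+
  show "\<forall>\<xi>\<in>{- sqrt pi<..<sqrt pi}. finite_rank_L2w (P_lambda \<xi>)"
    by (intro ballI finite_rank_P_lambda) (simp add: abs_less_iff)
  show "finite_rank_Hm1w (P_edge (sqrt pi))" "finite_rank_Hm1w (P_edge (- sqrt pi))"
    by (intro finite_rank_P_edge sp)+
  show "\<exists>C :: real \<Rightarrow> real. \<forall>\<xi>. \<xi> \<noteq> sqrt pi \<and> \<xi> \<noteq> - sqrt pi \<longrightarrow>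
      (\<forall>f\<in>L2w. \<forall>g\<in>L2w. cmod (inner_w (P_lambda \<xi> f) g) \<le> C \<xi> * norm_L2w f * norm_L2w g)"
    by (intro exI[of _ "\<lambda>\<xi>. 2 * exp 4 / (1 + lambda_star \<xi>)\<^sup>2"]) (use P_lambda_L2w_bound in blast)
  let ?e = "\<lambda>\<xi>. cmod (1 / omega_plus_deriv \<xi>)"
  let ?C = "(2 * exp 4 + ?e (sqrt pi) + ?e (- sqrt pi)) * cauchy_const\<^sup>2"
  have "cmod (P_pairing \<xi> f g) \<le> ?C * norm_H1w f * norm_H1w g" if fg: "f \<in> H1w" "g \<in> H1w" for \<xi> f g
  proof -
    have mono: "c * cauchy_const\<^sup>2 * norm_H1w f * norm_H1w g \<le> ?C * norm_H1w f * norm_H1w g"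
      if "c \<le> 2 * exp 4 + ?e (sqrt pi) + ?e (- sqrt pi)" for c
      using that by (intro mult_right_mono norm_H1w_nonneg) auto
    consider "\<bar>\<xi>\<bar> \<noteq> sqrt pi" | "\<xi> = sqrt pi" | "\<xi> = - sqrt pi" by linarith
    then show ?thesis
    proof cases
      case 1
      then show ?thesis
        using order_trans[OF P_lambda_H1w_bound[OF fg] mono] by (simp add: P_pairing_def)
    next
      case 2
      then show ?thesis
        using order_trans[OF P_edge_H1w_bound[OF sp(1,2) fg] mono] by (simp add: P_pairing_def)
    next
      case 3
      then show ?thesis
        using order_trans[OF P_edge_H1w_bound[OF sp(3,4) fg] mono] by (simp add: P_pairing_def)
    qed
  qed
  then show "\<exists>C :: real. \<forall>\<xi>. \<forall>f\<in>H1w. \<forall>g\<in>H1w. cmod (P_pairing \<xi> f g) \<le> C * norm_H1w f * norm_H1w g"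
    by blast
qed

end
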